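(* Let $(W,S)$ be the Coxeter system of type $\mathrm{D}_6$ with $S=\{s_1,\dots,s_6\}$ as in the context, and let $X\le W$ be the subgroup, a Coxeter group of type $\mathrm{H}_3$, generated by $T=\{t_1,t_2,t_3\}$ where $t_1=s_2s_4$, $t_2=s_3s_5$, $t_3=s_1s_6$. For $x\in X$, let $\mathcal{T}_X(x)$ be the set of tilings of the polygon $Y(x)$ that correspond to $\Sigma$-consistent reduced words of $x$, where $\Sigma=\{\{s_2,s_4\},\{s_3,s_5\},\{s_1,s_6\}\}$. Then for every $x\in X$ there is a bijection between the set of all reduced words for $x$ over $T$ and $\mathcal{T}_X(x)$.
   Context: **The groups.** $W$ of type $\mathrm{D}_6$ acts on $\{\pm1,\dots,\pm6\}$ with $s_1=(1,-2)(2,-1)$, $s_2=(1,2)(-1,-2)$, $s_i=(i-1,i)(-(i-1),-i)$ for $3\le i\le 6$ (so in the Coxeter diagram nodes $1$ and $2$ are both joined to $3$, and $3,4,5,6$ is a path). $(X,T)$ is a Coxeter system of type $\mathrm{H}_3$ with $m(t_1,t_2)=5$, $m(t_2,t_3)=3$, $m(t_1,t_3)=2$. A word over $S$ is $\Sigma$-consistent if it is a concatenation of blocks, each block being a reduced word over $S$ for one of $t_1,t_2,t_3$. Replacing each letter of a reduced word over $T$ by a reduced word over $S$ for the corresponding $t_i$ gives a reduced word in $W$ (Mühlherr). **Polygons and tilings.** Let $n=6$. For $w\in W$, $Y(w)$ is a $4n$-gon with unit edges, top vertex $U$ and bottom vertex $L$ on a vertical line: the left path from $U$ down to $L$ is convex,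 symmetric about the horizontal line through its middle vertex, with edges labelled $n,n-1,\dots,1,-1,\dots,-n$ in this order, each edge making an angle greater than $\pi/3$ with the horizontal; the right path $B(w)$, read from $L$ upwards, has edges in positions $-n,\dots,-1,1,\dots,n$, the edge in position $i$ being a translate of the left edge labelled $w^{-1}(i)$. $B(\mathrm{id})$ is the left path. The tiles are rhombi and megatiles. A megatile is an octagon with unit edges, with top and bottom vertices on a vertical line, whose left path $E$ (the first four edges anticlockwise from the top vertex) is symmetric about the horizontal line through its middle vertex, and whose right path is obtained from $E$ by interchanging its first and second edges and interchanging its third and fourth edges, and then reflecting in the vertical line through the top and bottom vertices. **Correspondence of words and tilings.** Compose permutations from right to left. A reduced word $w=s_{i_1}\cdots s_{i_\ell}$ over $S$ gives elements $u_k=s_{i_{\ell-k+1}}\cdots s_{i_\ell}$ ($0\le k\le\ell$) and paths $B(u_0)=B(\mathrm{id}),\dots,B(u_\ell)=B(w)$ in $Y(w)$; consecutive paths bound a megatile if the letter added is $s_1$, and a mirror-symmetric pair of rhombi if the letter added is $s_i$ with $i\ge2$. These tiles form the tiling of $Y(w)$ corresponding to the word. It is known (Elnitsky) that two reduced words over $S$ for $w$ give the same tiling if and only if they differ by a sequence of interchanges of adjacent commuting letters other than the pair $\{s_1,s_2\}$. *)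

theory Defs
  imports "HOL-Analysis.Analysis" "HOL-Combinatorics.Permutations" "HOL-Algebra.Generated_Groups"
begin

section \<open>Words\<close>

text \<open>Words over a generating family \<open>g\<close> with index set \<open>I\<close> are lists of indices.\<close>

definition word_prod :: "(nat \<Rightarrow> 'a \<Rightarrow> 'a) \<Rightarrow> nat list \<Rightarrow> 'a \<Rightarrow> 'a" where
  "word_prod g ks = foldr (\<lambda>k f. g k \<circ> f) ks id"

definition words_for :: "nat set \<Rightarrow> (nat \<Rightarrow> 'a \<Rightarrow> 'a) \<Rightarrow> ('a \<Rightarrow> 'a) \<Rightarrow> nat list set" where
  "words_for I g w = {ks. set ks \<subseteq> I \<and> word_prod g ks = w}"

definition reduced_words :: "nat set \<Rightarrow> (nat \<Rightarrow> 'a \<Rightarrow> 'a) \<Rightarrow> ('a \<Rightarrow> 'a) \<Rightarrow> nat list set" where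
  "reduced_words I g w =
     {ks \<in> words_for I g w. \<forall>ls \<in> words_for I g w. length ks \<le> length ls}"


section \<open>The groups of type D6 and H3\<close>

definition sD :: "nat \<Rightarrow> int \<Rightarrow> int" where
  "sD i = (if i = 1 then Transposition.transpose 1 (- 2) \<circ> Transposition.transpose 2 (- 1)
           else Transposition.transpose (int i - 1) (int i) \<circ>
                Transposition.transpose (- (int i - 1)) (- int i))"

definition tH :: "nat \<Rightarrow> int \<Rightarrow> int" where
  "tH j = (if j = 1 then sD 2 \<circ> sD 4 else if j = 2 then sD 3 \<circ> sD 5 else sD 1 \<circ> sD 6)"

text \<open>Permutations of \<open>{\<plusminus>1,\<dots>,\<plusminus>6}\<close>, composed from right to left.\<close>

definition Sym12 :: "(int \<Rightarrow> int) monoid" where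
  "Sym12 = \<lparr>carrier = {p. p permutes ({- 6..6} - {0})}, monoid.mult = (\<circ>), one = id\<rparr>"

definition W_D6 :: "(int \<Rightarrow> int) monoid" where
  "W_D6 = Sym12\<lparr>carrier := generate Sym12 (sD ` {1..6})\<rparr>"

definition X_H3 :: "(int \<Rightarrow> int) set" where
  "X_H3 = generate W_D6 (tH ` {1..3})"

definition S_reduced_words :: "(int \<Rightarrow> int) \<Rightarrow> nat list set" where
  "S_reduced_words = reduced_words {1..6} sD"

definition T_reduced_words :: "(int \<Rightarrow> int) \<Rightarrow> nat list set" where
  "T_reduced_words = reduced_words {1..3} tH"

definition Sigma_consistent :: "nat list \<Rightarrow> bool" where
  "Sigma_consistent ks \<longleftrightarrow>
     (\<exists>bs. ks = concat bs \<and> (\<forall>b \<in> set bs. \<exists>j \<in> {1..3}. b \<in> S_reduced_words (tH j)))"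


section \<open>Paths and polygons in the plane\<close>

text \<open>The plane is \<open>complex\<close>. All paths are read downwards from their top vertex, so edges are given
  as downward unit vectors.\<close>

fun polyline :: "complex \<Rightarrow> complex list \<Rightarrow> complex set" where
  "polyline p [] = {p}"
| "polyline p (e # es) = closed_segment p (p + e) \<union> polyline (p + e) es"

text \<open>The closed region bounded by two paths with common end points. The paths may share edges; such
  edges belong to the region.\<close>

definition enclosed :: "complex set \<Rightarrow> complex set \<Rightarrow> complex set" where
  "enclosed A B = A \<union> B \<union> inside (A \<union> B)"

text \<open>The number \<open>\<theta> i\<close> is the angle with the horizontal of the left edges labelled \<open>i\<close> and \<open>-i\<close>.
  On the way down from the top vertex, the left path first moves left (labels \<open>6,\<dots>,1\<close>) and then,
  symmetrically, right (labels \<open>-1,\<dots>,-6\<close>). It is (strictly) convex iff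
  \<open>\<theta> 6 < \<dots> < \<theta> 1 < \<pi>/2\<close>.\<close>

definition edge_angles :: "(nat \<Rightarrow> real) \<Rightarrow> bool" where
  "edge_angles \<theta> \<longleftrightarrow>
     (\<forall>i \<in> {1..6}. pi / 3 < \<theta> i \<and> \<theta> i < pi / 2) \<and> strict_antimono_on {1..6} \<theta>"

definition edge :: "(nat \<Rightarrow> real) \<Rightarrow> int \<Rightarrow> complex" where
  "edge \<theta> a = (if a > 0 then - cis (\<theta> (nat a)) else cis (- \<theta> (nat (- a))))"

definition positions :: "int list" where
  "positions = [6, 5, 4, 3, 2, 1, - 1, - 2, - 3, - 4, - 5, - 6]"

definition B_edges :: "(nat \<Rightarrow> real) \<Rightarrow> (int \<Rightarrow> int) \<Rightarrow> complex list" where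
  "B_edges \<theta> w = map (\<lambda>i. edge \<theta> (inv_into UNIV w i)) positions"

definition B_path :: "(nat \<Rightarrow> real) \<Rightarrow> complex \<Rightarrow> (int \<Rightarrow> int) \<Rightarrow> complex set" where
  "B_path \<theta> U w = polyline U (B_edges \<theta> w)"

definition Y_polygon :: "(nat \<Rightarrow> real) \<Rightarrow> complex \<Rightarrow> (int \<Rightarrow> int) \<Rightarrow> complex set" where
  "Y_polygon \<theta> U w = enclosed (B_path \<theta> U id) (B_path \<theta> U w)"


section \<open>Tiles and tilings\<close>

definition rhombus :: "complex set \<Rightarrow> bool" where
  "rhombus R \<longleftrightarrow>
     (\<exists>p a b. norm a = 1 \<and> norm b = 1 \<and> a \<noteq> b \<and> a \<noteq> - b \<and>
        R = enclosed (polyline p [a, b]) (polyline p [b, a]))"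

text \<open>Reflection of a vector in a vertical line is \<open>\<lambda>e. - cnj e\<close>. Reflecting a downward path in a
  horizontal line and reading the result downwards again also sends each edge \<open>e\<close> to \<open>- cnj e\<close>, and
  reverses the order of the edges. The intersection condition says that the two paths
  bound a genuine octagon; \<open>Re (a + b) < 0\<close> says that \<open>E\<close> is its left path.\<close>

definition megatile :: "complex set \<Rightarrow> bool" where
  "megatile M \<longleftrightarrow>
     (\<exists>p a b c d E F.
        E = [a, b, c, d] \<and> F = map (\<lambda>e. - cnj e) [b, a, d, c] \<and>
        (\<forall>e \<in> set E. norm e = 1 \<and> Im e < 0) \<and>
        E = rev (map (\<lambda>e. - cnj e) E) \<and>
        Re (a + b) < 0 \<and>
        polyline p E \<inter> polyline p F = {p, p + sum_list E} \<and>
        M = enclosed (polyline p E) (polyline p F))"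

text \<open>If \<open>w\<close> fixes some labels then \<open>Y_polygon\<close> has one-dimensional parts, where the left path and
  \<open>B(w)\<close> coincide. No tile covers these, hence the condition on the interior.\<close>

definition tiling_of :: "complex set \<Rightarrow> complex set set \<Rightarrow> bool" where
  "tiling_of P \<T> \<longleftrightarrow>
     finite \<T> \<and> (\<forall>R \<in> \<T>. rhombus R \<or> megatile R) \<and>
     pairwise (\<lambda>R R'. interior R \<inter> interior R' = {}) \<T> \<and>
     interior P \<subseteq> \<Union>\<T> \<and> \<Union>\<T> \<subseteq> P"

text \<open>The region between \<open>B(u)\<close> and \<open>B(v)\<close> along the \<open>m\<close> edges that follow the first \<open>k\<close> edges.\<close>

definition sub_path :: "(nat \<Rightarrow> real) \<Rightarrow> complex \<Rightarrow> nat \<Rightarrow> nat \<Rightarrow> (int \<Rightarrow> int) \<Rightarrow> complex set" where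
  "sub_path \<theta> U k m w =
     polyline (U + sum_list (take k (B_edges \<theta> w))) (take m (drop k (B_edges \<theta> w)))"

definition tile_between ::
    "(nat \<Rightarrow> real) \<Rightarrow> complex \<Rightarrow> nat \<Rightarrow> nat \<Rightarrow> (int \<Rightarrow> int) \<Rightarrow> (int \<Rightarrow> int) \<Rightarrow> complex set" where
  "tile_between \<theta> U k m u v = enclosed (sub_path \<theta> U k m u) (sub_path \<theta> U k m v)"

text \<open>The paths \<open>B(u)\<close> and \<open>B(s\<^sub>i u)\<close> differ only in the positions \<open>2, 1, -1, -2\<close> if \<open>i = 1\<close>, and in the
  positions \<open>i, i - 1\<close> and \<open>- (i - 1), - i\<close> if \<open>i \<ge> 2\<close>.\<close>

definition step_tiles :: "(nat \<Rightarrow> real) \<Rightarrow> complex \<Rightarrow> nat \<Rightarrow> (int \<Rightarrow> int) \<Rightarrow> complex set set" where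
  "step_tiles \<theta> U i u =
     (if i = 1 then {tile_between \<theta> U 4 4 u (sD i \<circ> u)}
      else {tile_between \<theta> U (6 - i) 2 u (sD i \<circ> u), tile_between \<theta> U (4 + i) 2 u (sD i \<circ> u)})"

fun word_tiling :: "(nat \<Rightarrow> real) \<Rightarrow> complex \<Rightarrow> nat list \<Rightarrow> complex set set" where
  "word_tiling \<theta> U [] = {}"
| "word_tiling \<theta> U (k # ks) = step_tiles \<theta> U k (word_prod sD ks) \<union> word_tiling \<theta> U ks"

definition tilings_X :: "(nat \<Rightarrow> real) \<Rightarrow> complex \<Rightarrow> (int \<Rightarrow> int) \<Rightarrow> complex set set set" where
  "tilings_X \<theta> U x =
     {\<T>. tiling_of (Y_polygon \<theta> U x) \<T> \<and>
         (\<exists>ks \<in> S_reduced_words x. Sigma_consistent ks \<and> \<T> = word_tiling \<theta> U ks)}"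

end

theory Submission
  imports Defs
begin

text \<open>All edges point downwards, so every path is the graph of a piecewise linear function of the
  height, and the region enclosed by two paths with common end points, one weakly left of the other,
  is the region between the graphs. If every letter of a word lengthens the element, the successive
  paths move to the right and the tiles fill the polygon without overlaps.

  On \<open>X\<close>, two generators in the same block lengthen or shorten an element simultaneously: the labels
  can be replaced by real weights satisfying three linear relations with the golden ratio as
  coefficient, these relations are preserved by \<open>X\<close>, and they make the two relevant differences of
  weights positive multiples of each other. Hence reduced words over \<open>T\<close> expand to reduced words
  over \<open>S\<close> of twice the length, and every consistent reduced word arises in this way up to reversing
  blocks, which does not change the tiling.

  Two different reduced words over \<open>T\<close> of the same element first differ right of a common path, where
  their tilings contain overlapping tiles of different vertical extent, so the tilings are different.\<close>

section \<open>Paths as graphs over the height\<close>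

text \<open>The weights come from folding the diagram of D6 onto that of H3. Restricted to X, the
  reflection representation of W splits into two three-dimensional ones, exchanged by changing the
  sign of \<open>sqrt 5\<close>. On one of them the two simple roots of a block are proportional: on
  the path 2, 3, 4, 5 the inner roots 4 and 3 are \<open>golden\<close> times the outer roots 2 and
  5, as in the folding of A4 onto the symmetries of a pentagon, and the edges 1-3 and 5-6 carry the
  same ratio over to the roots 1 and 6. The weights form a vector of this subspace at which all
  simple roots are positive.

  Reducedness is defined as minimal length among all words, so a lower bound is wanted that X can
  attain. \<open>Dlength\<close> changes by exactly one with every letter, hence bounds the length
  of every word; greedy descent by whole blocks attains it on X.

  Tilings are families of point sets and carry no labels. Telling two of them apart must therefore
  use features of the sets themselves: whether interiors meet, and the range of heights of a
  tile.\<close>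

fun hpos :: "complex \<Rightarrow> complex list \<Rightarrow> real \<Rightarrow> real" where
  "hpos p [] y = Re p"
| "hpos p (e # es) y =
     (if y \<le> Im (p + e) then hpos (p + e) es y else Re p + (y - Im p) / Im e * Re e)"

definition down :: "complex list \<Rightarrow> bool" where
  "down es \<longleftrightarrow> (\<forall>e \<in> set es. Im e < 0)"

lemma down_simps [simp]:
  "down []" "down (e # es) \<longleftrightarrow> Im e < 0 \<and> down es" "down (es @ fs) \<longleftrightarrow> down es \<and> down fs"
  by (auto simp: down_def)

lemma sum_list_down: "down es \<Longrightarrow> Im (sum_list es) \<le> 0"
  by (induction es) auto

lemma hpos_top: "down es \<Longrightarrow> hpos p es (Im p) = Re p"
  by (induction es) auto

lemma hpos_bottom: "down es \<Longrightarrow> hpos p es (Im (p + sum_list es)) = Re (p + sum_list es)"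
proof (induction es arbitrary: p)
  case (Cons e es)
  then show ?case using Cons.IH[of "p + e"] sum_list_down[of es] by (auto simp: add.assoc)
qed simp

text \<open>The function is continued past the end points: constantly below the bottom, and along
  the first edge above the top. So continuity holds on the whole line, as
  \<open>inside_two_graphs\<close> requires.\<close>

lemma continuous_hpos: "down es \<Longrightarrow> continuous_on A (hpos p es)"
proof (induction es arbitrary: p A)
  case (Cons e es)
  have "continuous_on A (\<lambda>y. if y \<le> Im (p + e) then hpos (p + e) es y
                                 else Re p + (y - Im p) / Im e * Re e)"
    using Cons hpos_top[of es "p + e"]
    by (intro continuous_on_cases_le) (auto intro!: continuous_intros)
  then show ?case by simp
qed simp

text \<open>For empty \<open>es\<close> the continuations above the top differ (constant against
  linear), hence the bound \<open>y \<le> Im p\<close>.\<close>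

lemma hpos_append:
  assumes "down es" "down fs" "y \<le> Im p"
  shows "hpos p (es @ fs) y =
    (if y \<le> Im (p + sum_list es) then hpos (p + sum_list es) fs y else hpos p es y)"
  using assms
proof (induction es arbitrary: p)
  case (Cons e es)
  then show ?case using sum_list_down[of es] Cons.IH[of "p + e"] by (auto simp: add.assoc)
qed auto

lemma closed_segment_down:
  assumes "Im e < 0"
  shows "closed_segment p (p + e) =
    {z. Im (p + e) \<le> Im z \<and> Im z \<le> Im p \<and> Re z = Re p + (Im z - Im p) / Im e * Re e}"
proof (intro equalityI subsetI)
  fix z assume "z \<in> closed_segment p (p + e)"
  then obtain t where t: "0 \<le> t" "t \<le> 1" "z = (1 - t) *\<^sub>R p + t *\<^sub>R (p + e)"
    by (auto simp: in_segment)
  have "Im e \<le> t * Im e" "t * Im e \<le> 0"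
    using t assms by (auto simp: mult_le_cancel_right1 mult_le_0_iff)
  then show "z \<in> {z. Im (p + e) \<le> Im z \<and> Im z \<le> Im p \<and>
      Re z = Re p + (Im z - Im p) / Im e * Re e}"
    using t assms by (auto simp: algebra_simps)
next
  fix z assume z: "z \<in> {z. Im (p + e) \<le> Im z \<and> Im z \<le> Im p \<and>
      Re z = Re p + (Im z - Im p) / Im e * Re e}"
  define t where "t = (Im z - Im p) / Im e"
  have "0 \<le> t" "t \<le> 1" "z = (1 - t) *\<^sub>R p + t *\<^sub>R (p + e)"
    using z assms by (auto simp: t_def divide_simps complex_eq_iff algebra_simps)
  then show "z \<in> closed_segment p (p + e)" by (auto simp: in_segment)
qed

lemma polyline_eq_graph:
  assumes "down es"
  shows "polyline p es =
    {z. Im (p + sum_list es) \<le> Im z \<and> Im z \<le> Im p \<and> Re z = hpos p es (Im z)}"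
  using assms
proof (induction es arbitrary: p)
  case Nil
  then show ?case by (auto simp: complex_eq_iff)
next
  case (Cons e es)
  have "down es" "Im e < 0" using Cons.prems by auto
  have 1: "polyline (p + e) es = {z. Im (p + sum_list (e # es)) \<le> Im z \<and> Im z \<le> Im (p + e) \<and>
      Re z = hpos (p + e) es (Im z)}"
    using Cons by (simp add: add.assoc)
  show ?case
  proof (rule Set.set_eqI)
    fix z
    define L where "L = Re p + (Im z - Im p) / Im e * Re e"
    \<comment> \<open>At the joint height \<open>b\<close> both descriptions apply; they merge into
      one \<open>if\<close> because the first edge and the rest of the path meet there.\<close>
    have glue: "(b \<le> y \<and> y \<le> a \<and> x = L) \<or> (c \<le> y \<and> y \<le> b \<and> x = H) \<longleftrightarrow>
        c \<le> y \<and> y \<le> a \<and> x = (if y \<le> b then H else L)"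
      if "b < a" "c \<le> b" "y = b \<longrightarrow> L = H" for a b c x y H :: real
      using that by (cases "y = b"; cases "y \<le> b") auto
    have "z \<in> polyline p (e # es) \<longleftrightarrow>
        (Im (p + e) \<le> Im z \<and> Im z \<le> Im p \<and> Re z = L) \<or>
        (Im (p + sum_list (e # es)) \<le> Im z \<and> Im z \<le> Im (p + e) \<and> Re z = hpos (p + e) es (Im z))"
      unfolding polyline.simps closed_segment_down[OF \<open>Im e < 0\<close>] 1 L_def by blast
    also have "\<dots> \<longleftrightarrow> Im (p + sum_list (e # es)) \<le> Im z \<and> Im z \<le> Im p \<and>
        Re z = (if Im z \<le> Im (p + e) then hpos (p + e) es (Im z) else L)"
    proof (rule glue)
      show "Im z = Im (p + e) \<longrightarrow> L = hpos (p + e) es (Im z)"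
        using hpos_top[OF \<open>down es\<close>, of "p + e"] \<open>Im e < 0\<close> by (simp add: L_def)
    qed (use \<open>Im e < 0\<close> sum_list_down[OF \<open>down es\<close>] in auto)
    finally show "z \<in> polyline p (e # es) \<longleftrightarrow> z \<in> {z. Im (p + sum_list (e # es)) \<le> Im z \<and>
        Im z \<le> Im p \<and> Re z = hpos p (e # es) (Im z)}"
      by (simp add: L_def)
  qed
qed

section \<open>Regions between two graphs\<close>

definition hbetween :: "real \<Rightarrow> real \<Rightarrow> (real \<Rightarrow> real) \<Rightarrow> (real \<Rightarrow> real) \<Rightarrow> complex set" where
  "hbetween a b f g = {z. a \<le> Im z \<and> Im z \<le> b \<and> f (Im z) \<le> Re z \<and> Re z \<le> g (Im z)}"

lemma unbounded_horizontal_ray: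
  fixes z :: complex
  assumes "\<sigma> = 1 \<or> \<sigma> = -1"
  defines "L \<equiv> {w. Im w = Im z \<and> \<sigma> * Re z \<le> \<sigma> * Re w}"
  shows "\<not> bounded L"
proof
  assume "bounded L"
  then obtain B where B: "\<And>w. w \<in> L \<Longrightarrow> norm w \<le> B" unfolding bounded_iff by blast
  define w where "w = Complex (\<sigma> * (\<bar>B\<bar> + \<bar>Re z\<bar> + 1)) (Im z)"
  have "w \<in> L" using assms by (auto simp: w_def)
  then have "\<bar>Re w\<bar> \<le> B" using B abs_Re_le_cmod order_trans by blast
  then show False using assms(1) by (auto simp: w_def)
qed

text \<open>The graphs may touch between their ends, so \<open>S\<close> need not be a simple closed
  curve and the Jordan curve theorem does not apply as it stands. Instead, a connected set in the
  complement of \<open>S\<close> that meets the open set \<open>Q\<close> cannot leave it, because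
  the frontier of \<open>Q\<close> lies in \<open>S\<close>; and a point outside \<open>S\<close>
  and \<open>Q\<close> escapes to infinity along a horizontal ray.\<close>

lemma inside_two_graphs:
  fixes f g :: "real \<Rightarrow> real"
  assumes cont: "continuous_on UNIV f" "continuous_on UNIV g"
    and ends: "f a = g a" "f b = g b"
    and le: "\<And>y. a \<le> y \<Longrightarrow> y \<le> b \<Longrightarrow> f y \<le> g y"
  defines "S \<equiv> {z. a \<le> Im z \<and> Im z \<le> b \<and> Re z = f (Im z)} \<union>
               {z. a \<le> Im z \<and> Im z \<le> b \<and> Re z = g (Im z)}"
  shows "S \<union> inside S = hbetween a b f g"
proof -
  define Q where "Q = {z. a < Im z \<and> Im z < b \<and> f (Im z) < Re z \<and> Re z < g (Im z)}"
  have cont': "continuous_on UNIV (\<lambda>z. f (Im z))" "continuous_on UNIV (\<lambda>z. g (Im z))"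
    by (rule continuous_on_compose2[OF cont(1)] continuous_on_compose2[OF cont(2)];
        auto intro!: continuous_intros)+
  have Q: "hbetween a b f g = S \<union> Q" "Q \<inter> S = {}"
  proof -
    have strict: "a < Im z \<and> Im z < b" if "a \<le> Im z" "Im z \<le> b" "f (Im z) < Re z" "Re z < g (Im z)" for z
      using that ends by (metis less_asym' order_le_imp_less_or_eq order_less_trans)
    have "z \<in> hbetween a b f g \<longleftrightarrow> z \<in> S \<union> Q" for z
      using strict[of z] le[of "Im z"] unfolding hbetween_def S_def Q_def
      by (cases "Re z = f (Im z)"; cases "Re z = g (Im z)") auto
    then show "hbetween a b f g = S \<union> Q" by blast
    show "Q \<inter> S = {}" by (auto simp: S_def Q_def)
  qed
  have "open Q"
    unfolding Q_def
    by (intro open_Collect_conj open_Collect_less continuous_intros cont')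
  have closed: "closed (hbetween a b f g)"
    unfolding hbetween_def
    by (intro closed_Collect_conj closed_Collect_le continuous_intros cont')
  have bdd: "bounded Q"
  proof -
    have "compact (f ` {a..b})" "compact (g ` {a..b})"
      by (intro compact_continuous_image continuous_on_subset[OF cont(1)]
          continuous_on_subset[OF cont(2)]; simp)+
    then have "bounded (f ` {a..b})" "bounded (g ` {a..b})" by (simp_all add: compact_imp_bounded)
    then obtain c d where cd: "\<And>y. y \<in> {a..b} \<Longrightarrow> \<bar>f y\<bar> \<le> c" "\<And>y. y \<in> {a..b} \<Longrightarrow> \<bar>g y\<bar> \<le> d"
      unfolding bounded_iff by (metis imageI real_norm_def)
    have "norm z \<le> \<bar>c\<bar> + \<bar>d\<bar> + \<bar>a\<bar> + \<bar>b\<bar>" if "z \<in> Q" for z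
    proof -
      have "\<bar>Re z\<bar> \<le> \<bar>c\<bar> + \<bar>d\<bar>" "\<bar>Im z\<bar> \<le> \<bar>a\<bar> + \<bar>b\<bar>"
        using that cd(1)[of "Im z"] cd(2)[of "Im z"] by (auto simp: Q_def)
      then show ?thesis using cmod_le[of z] by linarith
    qed
    then show ?thesis unfolding bounded_iff by blast
  qed
  have "Q \<subseteq> inside S"
  proof
    fix z assume "z \<in> Q"
    let ?C = "connected_component_set (- S) z"
    have "z \<in> ?C" using \<open>z \<in> Q\<close> Q by (auto simp: connected_component_refl_eq)
    have "frontier Q \<subseteq> S"
    proof -
      have "closure Q \<subseteq> hbetween a b f g" using closed Q by (intro closure_minimal) auto
      then show ?thesis using Q \<open>open Q\<close> by (auto simp: frontier_def interior_open)
    qed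
    then have "?C \<inter> frontier Q = {}" using connected_component_subset[of "- S" z] by blast
    then have "?C \<subseteq> Q"
      using connected_Int_frontier[of ?C Q] \<open>z \<in> Q\<close> \<open>z \<in> ?C\<close> by blast
    then show "z \<in> inside S"
      using bdd \<open>z \<in> Q\<close> Q bounded_subset by (auto simp: inside_def)
  qed
  moreover have "inside S \<subseteq> S \<union> Q"
  proof (rule ccontr)
    assume "\<not> inside S \<subseteq> S \<union> Q"
    then obtain z where z: "z \<in> inside S" "z \<notin> S" "z \<notin> Q" by blast
    \<comment> \<open>The direction of the ray: to the left for points left of \<open>f\<close>, to
      the right otherwise.\<close>
    obtain \<sigma> :: real where \<sigma>: "\<sigma> = 1 \<or> \<sigma> = -1"
      and disj: "{w. Im w = Im z \<and> \<sigma> * Re z \<le> \<sigma> * Re w} \<inter> S = {}"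
    proof -
      have "z \<notin> hbetween a b f g" using z Q by auto
      then consider "\<not> (a \<le> Im z \<and> Im z \<le> b)" | "a \<le> Im z" "Im z \<le> b" "Re z < f (Im z)"
        | "a \<le> Im z" "Im z \<le> b" "g (Im z) < Re z"
        unfolding hbetween_def mem_Collect_eq by (metis not_le)
      then show ?thesis
      proof cases
        case 1
        then have "{w. Im w = Im z \<and> 1 * Re z \<le> 1 * Re w} \<inter> S = {}" by (auto simp: S_def)
        then show ?thesis using that by blast
      next
        case 2
        then have "{w. Im w = Im z \<and> -1 * Re z \<le> -1 * Re w} \<inter> S = {}"
          using le[of "Im z"] by (auto simp: S_def)
        then show ?thesis using that by blast
      next
        case 3
        then have "{w. Im w = Im z \<and> 1 * Re z \<le> 1 * Re w} \<inter> S = {}"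
          using le[of "Im z"] by (auto simp: S_def)
        then show ?thesis using that by blast
      qed
    qed
    let ?L = "{w. Im w = Im z \<and> \<sigma> * Re z \<le> \<sigma> * Re w}"
    have "convex ({w. Im w = Im z} \<inter> {w. \<sigma> * Re z \<le> \<sigma> * Re w})"
    proof (rule convex_Int)
      show "convex {w. Im w = Im z}" by (auto simp: convex_def algebra_simps simp flip: distrib_right)
      have "convex ((\<lambda>w. \<sigma> * Re w) -` {\<sigma> * Re z..})"
        by (intro convex_linear_vimage linearI) (auto simp: algebra_simps)
      then show "convex {w. \<sigma> * Re z \<le> \<sigma> * Re w}" by (simp add: vimage_def)
    qed
    then have "connected ?L" by (simp add: convex_connected Collect_conj_eq)
    then have "?L \<subseteq> connected_component_set (- S) z"
      using disj by (intro connected_component_maximal) auto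
    then have "\<not> bounded (connected_component_set (- S) z)"
      using unbounded_horizontal_ray[OF \<sigma>, of z] bounded_subset by blast
    then show False using z by (auto simp: inside_def)
  qed
  ultimately show ?thesis using Q by blast
qed

definition path_region :: "complex \<Rightarrow> complex list \<Rightarrow> complex list \<Rightarrow> complex set" where
  "path_region p es fs = hbetween (Im (p + sum_list es)) (Im p) (hpos p es) (hpos p fs)"

lemma enclosed_polylines:
  assumes "down es" "down fs" "sum_list es = sum_list fs"
    and "\<And>y. Im (p + sum_list es) \<le> y \<Longrightarrow> y \<le> Im p \<Longrightarrow> hpos p es y \<le> hpos p fs y"
  shows "enclosed (polyline p es) (polyline p fs) = path_region p es fs"
  unfolding enclosed_def path_region_def polyline_eq_graph[OF assms(1)] polyline_eq_graph[OF assms(2)]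
    assms(3)[symmetric]
proof (rule inside_two_graphs)
  show "hpos p es (Im (p + sum_list es)) = hpos p fs (Im (p + sum_list es))"
    using hpos_bottom assms(1-3) by metis
qed (use assms hpos_top continuous_hpos in auto)

section \<open>Paths moving to the right and the tiles they sweep out\<close>

definition left_of :: "complex \<Rightarrow> complex list \<Rightarrow> complex list \<Rightarrow> bool" where
  "left_of p es fs \<longleftrightarrow> down es \<and> down fs \<and> sum_list es = sum_list fs \<and>
     (\<forall>y. Im (p + sum_list es) < y \<longrightarrow> y < Im p \<longrightarrow> hpos p es y < hpos p fs y)"

lemma left_of_le:
  assumes "left_of p es fs" "Im (p + sum_list es) \<le> y" "y \<le> Im p"
  shows "hpos p es y \<le> hpos p fs y"
proof -
  have "down es" "down fs" "sum_list es = sum_list fs" using assms(1) by (auto simp: left_of_def)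
  then have "hpos p es y = hpos p fs y" if "y = Im p \<or> y = Im (p + sum_list es)"
    using that hpos_top hpos_bottom by metis
  then show ?thesis
    using assms unfolding left_of_def
    by (cases "y = Im p \<or> y = Im (p + sum_list es)") (auto intro: less_imp_le)
qed

lemma enclosed_left_of:
  "left_of p es fs \<Longrightarrow> enclosed (polyline p es) (polyline p fs) = path_region p es fs"
  using left_of_le by (intro enclosed_polylines) (auto simp: left_of_def)

lemma Im_image_enclosed:
  assumes "left_of p es fs"
  shows "Im ` enclosed (polyline p es) (polyline p fs) = {Im (p + sum_list es)..Im p}"
proof (intro equalityI subsetI)
  fix y assume y: "y \<in> {Im (p + sum_list es)..Im p}"
  then have "Complex (hpos p es y) y \<in> path_region p es fs"
    using left_of_le[OF assms] by (auto simp: path_region_def hbetween_def)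
  then show "y \<in> Im ` enclosed (polyline p es) (polyline p fs)"
    unfolding enclosed_left_of[OF assms] by (metis complex.sel(2) image_eqI)
qed (auto simp: enclosed_left_of[OF assms] path_region_def hbetween_def)

text \<open>The invariant for adding letters: \<open>es\<close> is the fixed left path and
  \<open>fs\<close> the current right one. Only heights at which the two paths are apart have to be
  covered, since no tile covers the parts where they coincide.\<close>

definition tiles_between :: "complex \<Rightarrow> complex list \<Rightarrow> complex list \<Rightarrow> complex set set \<Rightarrow> bool" where
  "tiles_between p es fs T \<longleftrightarrow>
     down es \<and> down fs \<and> sum_list es = sum_list fs \<and>
     (\<forall>y. Im (p + sum_list es) \<le> y \<longrightarrow> y \<le> Im p \<longrightarrow> hpos p es y \<le> hpos p fs y) \<and>
     finite T \<and> pairwise (\<lambda>R R'. interior R \<inter> interior R' = {}) T \<and>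
     \<Union>T \<subseteq> path_region p es fs \<and>
     {z \<in> path_region p es fs. hpos p es (Im z) < hpos p fs (Im z)} \<subseteq> \<Union>T"

lemma tiles_between_refl: "down es \<Longrightarrow> tiles_between p es es {}"
  by (auto simp: tiles_between_def)

lemma interior_shift_right:
  fixes z :: complex
  assumes "z \<in> interior R"
  obtains e where "e > 0" "z + complex_of_real e \<in> R"
proof -
  obtain d where d: "d > 0" "ball z d \<subseteq> R" using assms mem_interior by blast
  then have "z + complex_of_real (d / 2) \<in> ball z d" by (simp add: dist_norm)
  then show ?thesis using d that[of "d / 2"] by auto
qed

text \<open>The graph of \<open>g\<close> bounds one region on the right and the other on the left.
  A common point lies on it, and a shift to the right leaves the first region.\<close>

lemma interior_hbetween_Int:
  "interior (hbetween a b f g) \<inter> interior (hbetween c d g h) = {}"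
proof (rule ccontr)
  assume "\<not> ?thesis"
  then obtain z where z: "z \<in> interior (hbetween a b f g \<inter> hbetween c d g h)" by auto
  then have "z \<in> hbetween a b f g \<inter> hbetween c d g h" using interior_subset by blast
  moreover obtain e where "e > 0" "z + complex_of_real e \<in> hbetween a b f g \<inter> hbetween c d g h"
    using interior_shift_right[OF z] .
  ultimately show False by (auto simp: hbetween_def)
qed

text \<open>Since \<open>M\<close> and \<open>M'\<close> have the same end points, exchanging them
  changes the path only at the heights of the tile. The tile can thus be described by the graphs of
  the two whole paths, which is the form needed for stacking tiles.\<close>

lemma left_of_append:
  assumes downs: "down X" "down Z" and M: "left_of (p + sum_list X) M M'"
  defines "q \<equiv> p + sum_list X" and "f \<equiv> hpos p (X @ M @ Z)" and "g \<equiv> hpos p (X @ M' @ Z)"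
  defines "b \<equiv> Im (p + sum_list (X @ M @ Z))"
  shows "enclosed (polyline q M) (polyline q M') = hbetween (Im (q + sum_list M)) (Im q) f g"
    and "b \<le> y \<Longrightarrow> y \<le> Im p \<Longrightarrow> f y < g y \<longleftrightarrow> Im (q + sum_list M) < y \<and> y < Im q"
    and "b \<le> y \<Longrightarrow> y \<le> Im p \<Longrightarrow> f y \<le> g y"
    and "b \<le> Im (q + sum_list M)" "Im q \<le> Im p"
proof -
  have M': "down M" "down M'" "sum_list M' = sum_list M"
    using M by (auto simp: left_of_def)
  have eq: "f y = g y" if "y \<le> Im p" "y \<le> Im (q + sum_list M) \<or> Im q \<le> y" for y
    using that downs M' hpos_append[of X "M @ Z" y p] hpos_append[of X "M' @ Z" y p]
      hpos_append[of M Z y q] hpos_append[of M' Z y q] hpos_top[of "M @ Z" q] hpos_top[of "M' @ Z" q]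
      sum_list_down[of M]
    unfolding f_def g_def by (fold q_def) auto
  have restrict: "f y = hpos q M y" "g y = hpos q M' y"
    if "Im (q + sum_list M) \<le> y" "y \<le> Im q" for y
  proof -
    have "y \<le> Im p" using that sum_list_down[OF \<open>down X\<close>] by (simp add: q_def)
    then have "f y = hpos q (M @ Z) y" "g y = hpos q (M' @ Z) y"
      using that downs M' hpos_append[of X "M @ Z" y p] hpos_append[of X "M' @ Z" y p]
      unfolding f_def g_def by (auto simp flip: q_def)
    moreover have "hpos q (M @ Z) y = hpos q M y" "hpos q (M' @ Z) y = hpos q M' y"
      using that downs M' hpos_append[of M Z y q] hpos_append[of M' Z y q]
        hpos_top[of Z "q + sum_list M"] hpos_bottom[of M q] hpos_bottom[of M' q] by auto
    ultimately show "f y = hpos q M y" "g y = hpos q M' y" by simp_all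
  qed
  show "b \<le> Im (q + sum_list M)" "Im q \<le> Im p"
    using sum_list_down[OF \<open>down X\<close>] sum_list_down[OF \<open>down Z\<close>]
    by (auto simp: b_def q_def)
  show less_iff: "f y < g y \<longleftrightarrow> Im (q + sum_list M) < y \<and> y < Im q" if "b \<le> y" "y \<le> Im p" for y
    using eq[of y] that restrict[of y] M unfolding left_of_def q_def[symmetric] by force
  show "f y \<le> g y" if "b \<le> y" "y \<le> Im p" for y
    using less_iff[OF that] eq[of y] that by force
  show "enclosed (polyline q M) (polyline q M') = hbetween (Im (q + sum_list M)) (Im q) f g"
    unfolding enclosed_left_of[OF M[folded q_def]] path_region_def hbetween_def
    by (rule Collect_cong) (use restrict in \<open>auto simp del: plus_complex.simps\<close>)
qed

text \<open>Both tiles lie immediately to the right of the same path. At a height strictly inside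
  both ranges, a point close enough to that path is interior to both.\<close>

lemma moves_overlap:
  assumes P: "X @ M @ Z = X' @ N @ Z'" and downs: "down (X @ M @ Z)"
    and M: "left_of (p + sum_list X) M M'" and N: "left_of (p + sum_list X') N N'"
    and y: "Im (p + sum_list (X @ M)) < y" "y < Im (p + sum_list X)"
      "Im (p + sum_list (X' @ N)) < y" "y < Im (p + sum_list X')"
  shows "interior (enclosed (polyline (p + sum_list X) M) (polyline (p + sum_list X) M')) \<inter>
    interior (enclosed (polyline (p + sum_list X') N) (polyline (p + sum_list X') N')) \<noteq> {}"
proof -
  define f where "f = hpos p (X @ M @ Z)"
  define g where "g = hpos p (X @ M' @ Z)"
  define h where "h = hpos p (X' @ N' @ Z')"
  have d: "down X" "down Z" "down X'" "down Z'" "down M" "down N" "down M'" "down N'"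
    using downs downs[unfolded P] M N by (simp_all add: left_of_def)
  note m = left_of_append[OF d(1,2) M, folded f_def g_def]
  note n = left_of_append[OF d(3,4) N, folded P, folded f_def h_def]
  have "f y < g y" "f y < h y"
    using m(2)[of y] m(4,5) n(2)[of y] n(4,5) y by (auto simp: add.assoc)
  then obtain x where x: "f y < x" "x < g y" "x < h y"
    using dense[of "f y" "min (g y) (h y)"] by auto
  have cont: "continuous_on UNIV (\<lambda>z. f (Im z))" "continuous_on UNIV (\<lambda>z. g (Im z))"
    "continuous_on UNIV (\<lambda>z. h (Im z))"
    unfolding f_def g_def h_def
    by (rule continuous_on_compose2[OF continuous_hpos[of _ UNIV]];
        use d in \<open>auto intro!: continuous_intros\<close>)+
  have "Complex x y \<in> interior (hbetween a b f k)"
    if "a < y" "y < b" "x < k y" "continuous_on UNIV (\<lambda>z. k (Im z))" for a b k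
  proof (rule interiorI)
    show "open {z. a < Im z \<and> Im z < b \<and> f (Im z) < Re z \<and> Re z < k (Im z)}"
      by (intro open_Collect_conj open_Collect_less continuous_intros cont that)
  qed (use that x in \<open>auto simp: hbetween_def\<close>)
  then show ?thesis
    unfolding m(1) n(1) using x y cont
    by (intro ex_in_conv[THEN iffD1] exI[of _ "Complex x y"] IntI) (simp_all add: add.assoc)
qed

lemma tiles_between_step:
  assumes T: "tiles_between p es (X @ M @ Z) T"
    and M: "left_of (p + sum_list X) M M'"
  shows "tiles_between p es (X @ M' @ Z)
    (insert (enclosed (polyline (p + sum_list X) M) (polyline (p + sum_list X) M')) T)"
proof -
  define q where "q = p + sum_list X"
  define a where "a = Im (p + sum_list es)"
  define fs where "fs = X @ M @ Z"
  define gs where "gs = X @ M' @ Z"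
  let ?R = "enclosed (polyline q M) (polyline q M')"
  have downs: "down es" "down X" "down M" "down Z" "down M'"
    and sums: "sum_list es = sum_list fs" "sum_list M' = sum_list M"
    and le: "\<And>y. a \<le> y \<Longrightarrow> y \<le> Im p \<Longrightarrow> hpos p es y \<le> hpos p fs y"
    and T': "finite T" "pairwise (\<lambda>R R'. interior R \<inter> interior R' = {}) T" "\<Union>T \<subseteq> path_region p es fs"
      "{z \<in> path_region p es fs. hpos p es (Im z) < hpos p fs (Im z)} \<subseteq> \<Union>T"
    using T M unfolding tiles_between_def left_of_def fs_def a_def by auto
  note append = left_of_append[OF downs(2,4) M, folded q_def fs_def gs_def]
  have a: "Im (p + sum_list fs) = a" using sums by (simp add: a_def)
  have less_iff: "hpos p fs y < hpos p gs y \<longleftrightarrow> Im (q + sum_list M) < y \<and> y < Im q"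
    and le': "hpos p fs y \<le> hpos p gs y" if "a \<le> y" "y \<le> Im p" for y
    using append(2,3) that unfolding a by auto
  have range: "a \<le> Im (q + sum_list M)" "Im q \<le> Im p"
    using append(4,5) unfolding a by auto
  have R: "?R = hbetween (Im (q + sum_list M)) (Im q) (hpos p fs) (hpos p gs)"
    by (rule append(1))
  have bet: "path_region p es fs = hbetween a (Im p) (hpos p es) (hpos p fs)"
    "path_region p es gs = hbetween a (Im p) (hpos p es) (hpos p gs)"
    by (auto simp: path_region_def a_def)
  have "interior ?R \<inter> interior R' = {}" if "R' \<in> T" for R'
  proof -
    have "interior R' \<subseteq> interior (path_region p es fs)" using T' that by (intro interior_mono) auto
    then show ?thesis unfolding bet R using interior_hbetween_Int by blast
  qed
  then have "pairwise (\<lambda>R R'. interior R \<inter> interior R' = {}) (insert ?R T)"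
    using T' by (auto simp: pairwise_insert)
  moreover have "\<Union>(insert ?R T) \<subseteq> path_region p es gs"
  proof -
    have "?R \<subseteq> path_region p es gs"
      unfolding R bet hbetween_def using range le by (auto intro: order_trans)
    moreover have "path_region p es fs \<subseteq> path_region p es gs"
      unfolding bet hbetween_def using le' by (auto intro: order_trans)
    ultimately show ?thesis using T' by auto
  qed
  moreover have "{z \<in> path_region p es gs. hpos p es (Im z) < hpos p gs (Im z)} \<subseteq> \<Union>(insert ?R T)"
  proof
    fix z assume "z \<in> {z \<in> path_region p es gs. hpos p es (Im z) < hpos p gs (Im z)}"
    then have z: "a \<le> Im z" "Im z \<le> Im p" "hpos p es (Im z) \<le> Re z" "Re z \<le> hpos p gs (Im z)"
      "hpos p es (Im z) < hpos p gs (Im z)" by (auto simp: bet hbetween_def)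
    show "z \<in> \<Union>(insert ?R T)"
    \<comment> \<open>If \<open>es\<close> and \<open>fs\<close> are apart at this height and the
      point is not right of \<open>fs\<close>, an old tile covers it. Otherwise it lies between
      \<open>fs\<close> and \<open>gs\<close>, at a height where these differ, hence in the new
      tile.\<close>
    proof (cases "hpos p es (Im z) < hpos p fs (Im z) \<and> Re z \<le> hpos p fs (Im z)")
      case True
      then have "z \<in> {z \<in> path_region p es fs. hpos p es (Im z) < hpos p fs (Im z)}"
        using z by (auto simp: bet hbetween_def)
      then show ?thesis using T' by blast
    next
      case False
      then have "hpos p fs (Im z) \<le> Re z" "hpos p fs (Im z) < hpos p gs (Im z)"
        using le[of "Im z"] z by auto
      then have "z \<in> ?R" using less_iff[of "Im z"] z by (auto simp: R hbetween_def)
      then show ?thesis by simp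
    qed
  qed
  moreover have "hpos p es y \<le> hpos p gs y" if "a \<le> y" "y \<le> Im p" for y
    using le le' that order_trans by blast
  ultimately show ?thesis
    unfolding tiles_between_def gs_def[symmetric] q_def[symmetric] a_def[symmetric]
    using T' downs sums by (auto simp: gs_def fs_def)
qed

lemma tiling_of_enclosed:
  assumes "tiles_between p es fs T" "\<And>R. R \<in> T \<Longrightarrow> rhombus R \<or> megatile R"
  shows "tiling_of (enclosed (polyline p es) (polyline p fs)) T"
proof -
  have "down es" "down fs" "sum_list es = sum_list fs"
    and le: "\<And>y. Im (p + sum_list es) \<le> y \<Longrightarrow> y \<le> Im p \<Longrightarrow> hpos p es y \<le> hpos p fs y"
    and T: "finite T" "pairwise (\<lambda>R R'. interior R \<inter> interior R' = {}) T" "\<Union>T \<subseteq> path_region p es fs"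
      "{z \<in> path_region p es fs. hpos p es (Im z) < hpos p fs (Im z)} \<subseteq> \<Union>T"
    using assms(1) by (auto simp: tiles_between_def)
  then have E: "enclosed (polyline p es) (polyline p fs) = path_region p es fs"
    by (intro enclosed_polylines)
  have "interior (path_region p es fs) \<subseteq> \<Union>T"
  proof
    fix z assume z: "z \<in> interior (path_region p es fs)"
    then have "z \<in> path_region p es fs" using interior_subset by blast
    moreover obtain e where "e > 0" "z + complex_of_real e \<in> path_region p es fs"
      using interior_shift_right[OF z] .
    ultimately have "hpos p es (Im z) < hpos p fs (Im z)"
      by (auto simp: path_region_def hbetween_def)
    then show "z \<in> \<Union>T" using T \<open>z \<in> path_region p es fs\<close> by blast
  qed
  then show ?thesis unfolding E tiling_of_def using T assms(2) by auto
qed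

section \<open>Moves by rhombi and megatiles\<close>

text \<open>Two-edge paths as functions of the depth \<open>h\<close> below the top vertex: \<open>x1\<close>, \<open>x2\<close> are the horizontal and
  \<open>d1\<close>, \<open>d2\<close> the vertical extents of the edges.\<close>

definition bent :: "real \<Rightarrow> real \<Rightarrow> real \<Rightarrow> real \<Rightarrow> real \<Rightarrow> real \<Rightarrow> real" where
  "bent x x1 d1 x2 d2 h = (if h < d1 then x + h / d1 * x1 else x + x1 + (h - d1) / d2 * x2)"

lemma hpos_two:
  assumes "Im (p + e1 + e2) < y"
  shows "hpos p [e1, e2] y = bent (Re p) (Re e1) (- Im e1) (Re e2) (- Im e2) (Im p - y)"
  using assms by (auto simp: bent_def minus_divide_left minus_divide_right divide_simps algebra_simps)

lemma affine_pos:
  fixes \<alpha> \<beta> :: real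
  assumes "l < h" "h < r" "0 \<le> \<alpha> + \<beta> * l" "0 \<le> \<alpha> + \<beta> * r"
    and "0 < \<alpha> + \<beta> * l \<or> 0 < \<alpha> + \<beta> * r"
  shows "0 < \<alpha> + \<beta> * h"
proof -
  consider "\<beta> = 0" | "\<beta> > 0" | "\<beta> < 0" by linarith
  then show ?thesis
  proof cases
    case 2
    then have "\<beta> * l < \<beta> * h" using assms(1) by simp
    then show ?thesis using assms by linarith
  next
    case 3
    then have "\<beta> * r < \<beta> * h" using assms(2) by simp
    then show ?thesis using assms by linarith
  qed (use assms in auto)
qed

text \<open>The vertical extents occur in opposite orders, so one function bends at depth
  \<open>d1\<close> and the other at \<open>d2\<close>. Their difference is affine on the three
  pieces in between, and weak inequality at the ends with strict inequality at the two corners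
  suffices on each piece.\<close>

lemma bent_less_aux:
  assumes d: "0 < d1" "d1 \<le> d2"
    and ends: "x \<le> x'" "x + x1 + x2 \<le> x' + u1 + u2"
    and corners: "bent x x1 d1 x2 d2 d1 < bent x' u1 d2 u2 d1 d1"
      "bent x x1 d1 x2 d2 d2 < bent x' u1 d2 u2 d1 d2"
    and h: "0 < h" "h < d1 + d2"
  shows "bent x x1 d1 x2 d2 h < bent x' u1 d2 u2 d1 h"
proof -
  have c1: "x + x1 < x' + d1 / d2 * u1" and c2: "x + x1 + (d2 - d1) / d2 * x2 < x' + u1"
    using corners d by (cases "d1 = d2"; simp add: bent_def)+
  have "d1 \<noteq> 0" "d2 \<noteq> 0" using d by auto
  consider "h = d1" | "h = d2" | "h < d1" | "d1 < h" "h < d2" | "d2 < h" by linarith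
  then show ?thesis
  proof cases
    case 3
    have "(u1 / d2 - x1 / d1) * d1 = d1 / d2 * u1 - x1"
      using \<open>d1 \<noteq> 0\<close> by (simp add: algebra_simps)
    then have "0 < (x' - x) + (u1 / d2 - x1 / d1) * h"
      using 3 ends c1 h by (intro affine_pos[of 0 h d1]) auto
    then show ?thesis using 3 d by (simp add: bent_def algebra_simps)
  next
    case 4
    define \<alpha> where "\<alpha> = x' - x - x1 + d1 / d2 * x2"
    have "\<alpha> + (u1 / d2 - x2 / d2) * d1 = x' + d1 / d2 * u1 - x - x1"
      "\<alpha> + (u1 / d2 - x2 / d2) * d2 = x' + u1 - (x + x1 + (d2 - d1) / d2 * x2)"
      using \<open>d2 \<noteq> 0\<close> by (simp_all add: \<alpha>_def algebra_simps diff_divide_distrib)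
    then have "0 < \<alpha> + (u1 / d2 - x2 / d2) * h"
      using 4 c1 c2 by (intro affine_pos[of d1 h d2]) auto
    then show ?thesis using 4 d by (simp add: \<alpha>_def bent_def algebra_simps diff_divide_distrib)
  next
    case 5
    define \<alpha> where "\<alpha> = x' + u1 - d2 / d1 * u2 - x - x1 + d1 / d2 * x2"
    have "\<alpha> + (u2 / d1 - x2 / d2) * d2 = x' + u1 - (x + x1 + (d2 - d1) / d2 * x2)"
      "\<alpha> + (u2 / d1 - x2 / d2) * (d1 + d2) = x' + u1 + u2 - (x + x1 + x2)"
      using \<open>d1 \<noteq> 0\<close> \<open>d2 \<noteq> 0\<close> by (simp_all add: \<alpha>_def algebra_simps diff_divide_distrib add_divide_distrib)
    then have "0 < \<alpha> + (u2 / d1 - x2 / d2) * h"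
      using 5 h ends c2 by (intro affine_pos[of d2 h "d1 + d2"]) auto
    then show ?thesis using 5 d by (simp add: \<alpha>_def bent_def algebra_simps diff_divide_distrib)
  qed (use corners in auto)
qed

lemma bent_minus: "bent (- x) (- x1) d1 (- x2) d2 h = - bent x x1 d1 x2 d2 h"
  by (simp add: bent_def)

lemma bent_less:
  assumes d: "0 < d1" "0 < d2"
    and ends: "x \<le> x'" "x + x1 + x2 \<le> x' + u1 + u2"
    and corners: "bent x x1 d1 x2 d2 d1 < bent x' u1 d2 u2 d1 d1"
      "bent x x1 d1 x2 d2 d2 < bent x' u1 d2 u2 d1 d2"
    and h: "0 < h" "h < d1 + d2"
  shows "bent x x1 d1 x2 d2 h < bent x' u1 d2 u2 d1 h"
proof (cases "d1 \<le> d2")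
  case True
  then show ?thesis using assms by - (rule bent_less_aux; simp)
next
  case False
  \<comment> \<open>Reflection in a vertical line exchanges the two paths, and with them
    \<open>d1\<close> and \<open>d2\<close>.\<close>
  then have "bent (- x') (- u1) d2 (- u2) d1 h < bent (- x) (- x1) d1 (- x2) d2 h"
    using assms by - (rule bent_less_aux; simp add: bent_minus)
  then show ?thesis by (simp add: bent_minus)
qed

text \<open>The hypothesis \<open>cross\<close> compares slopes: \<open>a\<close> leans further to
  the left than \<open>b\<close>, so taking \<open>a\<close> first stays on the left.\<close>

lemma left_of_two:
  assumes "Im a < 0" "Im b < 0" and cross: "Re a * - Im b < Re b * - Im a"
  shows "left_of p [a, b] [b, a]"
proof -
  define c d where "c = - Im a" "d = - Im b"
  define x y where "x = Re a" "y = Re b"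
  have cd: "0 < c" "0 < d" "x * d < y * c" using assms by (auto simp: c_d_def x_y_def)
  then have corner: "x < c / d * y" "d / c * x < y" and "c \<noteq> 0" "d \<noteq> 0"
    by (simp_all add: field_simps)
  have "bent r x c y d h < bent r y d x c h" if "0 < h" "h < c + d" for r h
  proof (rule bent_less)
    show "bent r x c y d c < bent r y d x c c"
      using corner \<open>c \<noteq> 0\<close> by (auto simp: bent_def diff_divide_distrib left_diff_distrib)
    show "bent r x c y d d < bent r y d x c d"
      using corner \<open>d \<noteq> 0\<close> by (auto simp: bent_def diff_divide_distrib left_diff_distrib)
  qed (use cd that in auto)
  then have "hpos p [a, b] t < hpos p [b, a] t" if "Im (p + a + b) < t" "t < Im p" for t
    using that hpos_two[of p a b t] hpos_two[of p b a t] by (simp add: add_ac c_d_def x_y_def)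
  then show ?thesis using assms by (auto simp: left_of_def add_ac)
qed

text \<open>Both paths are symmetric about the horizontal line through the middle, so the upper and
  lower halves lead to the same conditions. In each half, \<open>cross\<close> is the comparison at
  the corner of depth \<open>min c d\<close>, and \<open>qa\<close>, \<open>qb\<close> are the
  comparison at the corner of depth \<open>max c d\<close>, where \<open>c\<close> and
  \<open>d\<close> are the vertical extents.\<close>

lemma left_of_four:
  assumes neg: "Im a < 0" "Im b < 0" and sum: "Re a + Re b < 0"
    and cross: "Re a * - Im b + Re b * - Im a < 0"
    and qa: "- Im a \<le> - Im b \<Longrightarrow> 2 * Re b * - Im b + Re a * - Im b - Re b * - Im a < 0"
    and qb: "- Im b \<le> - Im a \<Longrightarrow> 2 * Re a * - Im a + Re b * - Im a - Re a * - Im b < 0"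
  shows "left_of p [a, b, - cnj b, - cnj a] [- cnj b, - cnj a, a, b]"
proof -
  define x y where "x = Re a" "y = Re b"
  define c d where "c = - Im a" "d = - Im b"
  define q where "q = p + a + b"
  define q' where "q' = p - cnj b - cnj a"
  have cd: "0 < c" "0 < d" "x + y < 0" "x * d + y * c < 0"
    "c \<le> d \<Longrightarrow> 2 * y * d + x * d - y * c < 0" "d \<le> c \<Longrightarrow> 2 * x * c + y * c - x * d < 0"
    using assms by (auto simp: x_y_def c_d_def)
  have q: "Re q = Re p + x + y" "Re q' = Re p - y - x" "Im q' = Im q" "Im q = Im p - c - d"
    by (auto simp: q_def q'_def x_y_def c_d_def)
  have corner: "x + c / d * y < 0" "y + d / c * x < 0"
    "c \<le> d \<Longrightarrow> 2 * y + x - c / d * y < 0" "d \<le> c \<Longrightarrow> 2 * x + y - d / c * x < 0"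
    using cd by (simp_all add: field_simps)
  have "c \<noteq> 0" "d \<noteq> 0" using cd by auto
  note bent_simps = bent_def diff_divide_distrib left_diff_distrib
  have upper: "bent r x c y d h < bent r (- y) d (- x) c h" if "0 < h" "h < c + d" for r h
  proof (rule bent_less)
    show "bent r x c y d c < bent r (- y) d (- x) c c"
      using corner \<open>c \<noteq> 0\<close> by (auto simp: bent_simps)
    show "bent r x c y d d < bent r (- y) d (- x) c d"
      using corner \<open>d \<noteq> 0\<close> by (auto simp: bent_simps)
  qed (use cd that in auto)
  have lower: "bent (r + x + y) (- y) d (- x) c h < bent (r - y - x) x c y d h"
    if "0 \<le> h" "h < c + d" for r h
  \<comment> \<open>At \<open>h = 0\<close> the paths are at the middle vertices, which are already
    apart because \<open>x + y < 0\<close>; \<open>bent_less\<close> applies only below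
    them.\<close>
  proof (cases "h = 0")
    case False
    show ?thesis
    proof (rule bent_less)
      show "bent (r + x + y) (- y) d (- x) c d < bent (r - y - x) x c y d d"
        using corner \<open>d \<noteq> 0\<close> by (auto simp: bent_simps)
      show "bent (r + x + y) (- y) d (- x) c c < bent (r - y - x) x c y d c"
        using corner \<open>c \<noteq> 0\<close> by (auto simp: bent_simps)
    qed (use cd that False in auto)
  qed (use cd in \<open>auto simp: bent_def\<close>)
  have "hpos p [a, b, - cnj b, - cnj a] t < hpos p [- cnj b, - cnj a, a, b] t"
    if t: "Im (q + - cnj b + - cnj a) < t" "t < Im p" for t
  proof (cases "t \<le> Im q")
    case False
    have "hpos p [a, b] t < hpos p [- cnj b, - cnj a] t"
      using upper[of "Im p - t" "Re p"] False q t hpos_two[of p a b t]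
        hpos_two[of p "- cnj b" "- cnj a" t]
      by (auto simp: x_y_def c_d_def)
    moreover have "hpos p ([a, b] @ [- cnj b, - cnj a]) t = hpos p [a, b] t"
      using t False neg q by (subst hpos_append) (auto simp: q_def add_ac)
    moreover have "hpos p ([- cnj b, - cnj a] @ [a, b]) t = hpos p [- cnj b, - cnj a] t"
      using t False neg q by (subst hpos_append) (auto simp: q_def q'_def add_ac)
    ultimately show ?thesis by simp
  next
    case True
    have "0 \<le> Im q - t" "Im q - t < c + d" using True t by (auto simp: c_d_def)
    then have "hpos q [- cnj b, - cnj a] t < hpos q' [a, b] t"
      using lower[of "Im q - t" "Re p"] t hpos_two[of q' a b t] hpos_two[of q "- cnj b" "- cnj a" t]
      unfolding q(1-3)[symmetric] by (simp add: x_y_def c_d_def q(3))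
    moreover have "hpos p ([a, b] @ [- cnj b, - cnj a]) t = hpos q [- cnj b, - cnj a] t"
      using t True neg by (subst hpos_append) (auto simp: q_def add_ac)
    moreover have "hpos p ([- cnj b, - cnj a] @ [a, b]) t = hpos q' [a, b] t"
      using t True neg q by (subst hpos_append) (auto simp: q_def q'_def add_ac)
    ultimately show ?thesis by simp
  qed
  then show ?thesis using neg by (auto simp: left_of_def q_def complex_eq_iff add_ac)
qed

lemma rhombus_enclosed:
  assumes "norm a = 1" "norm b = 1" "Im a < 0" "Im b < 0" "Re a * - Im b < Re b * - Im a"
  shows "rhombus (enclosed (polyline p [a, b]) (polyline p [b, a]))"
proof -
  have "a \<noteq> b" "a \<noteq> - b" using assms by auto
  then show ?thesis unfolding rhombus_def using assms by blast
qed

lemma megatile_enclosed: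
  assumes "norm a = 1" "norm b = 1" "Im a < 0" "Im b < 0" "Re a + Re b < 0"
    and left: "left_of p [a, b, - cnj b, - cnj a] [- cnj b, - cnj a, a, b]"
  shows "megatile (enclosed (polyline p [a, b, - cnj b, - cnj a])
                            (polyline p [- cnj b, - cnj a, a, b]))"
proof -
  let ?E = "[a, b, - cnj b, - cnj a]" and ?F = "[- cnj b, - cnj a, a, b]"
  have d: "down ?E" "down ?F" and sums: "sum_list ?E = sum_list ?F"
    using left by (auto simp: left_of_def)
  have "polyline p ?E \<inter> polyline p ?F = {p, p + sum_list ?E}"
  proof (intro equalityI subsetI)
    fix z assume "z \<in> polyline p ?E \<inter> polyline p ?F"
    then have z: "Im (p + sum_list ?E) \<le> Im z" "Im z \<le> Im p" "Re z = hpos p ?E (Im z)"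
      "Re z = hpos p ?F (Im z)"
      unfolding polyline_eq_graph[OF d(1)] polyline_eq_graph[OF d(2)] by blast+
    have "\<not> (Im (p + sum_list ?E) < Im z \<and> Im z < Im p)"
      using left z(3,4) unfolding left_of_def by (metis less_irrefl)
    then have "Im z = Im p \<or> Im z = Im (p + sum_list ?E)" using z by linarith
    then show "z \<in> {p, p + sum_list ?E}"
      using z(3) hpos_top[OF d(1)] hpos_bottom[OF d(1)] by (metis complex_eqI insertCI)
  next
    fix z assume "z \<in> {p, p + sum_list ?E}"
    then show "z \<in> polyline p ?E \<inter> polyline p ?F"
      unfolding polyline_eq_graph[OF d(1)] polyline_eq_graph[OF d(2)]
      using sums hpos_top[OF d(1), of p] hpos_top[OF d(2), of p]
        hpos_bottom[OF d(1), of p] hpos_bottom[OF d(2), of p] sum_list_down[OF d(1)]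
      by (elim insertE) (simp_all only: Int_iff mem_Collect_eq plus_complex.simps, auto)
  qed
  note meet = this
  have EF: "?E = rev (map (\<lambda>e. - cnj e) ?E)" "?F = map (\<lambda>e. - cnj e) [b, a, - cnj a, - cnj b]"
    "\<forall>e \<in> set ?E. norm e = 1 \<and> Im e < 0" "Re (a + b) < 0"
    using assms by simp_all
  show ?thesis
    unfolding megatile_def
    by (rule exI[of _ p], rule exI[of _ a], rule exI[of _ b], rule exI[of _ "- cnj b"],
        rule exI[of _ "- cnj a"], rule exI[of _ ?E], rule exI[of _ ?F])
      (intro conjI refl EF meet)
qed

section \<open>Labelled edges\<close>

lemma edge_Re_Im:
  "Re (edge \<theta> a) = (if a > 0 then - cos (\<theta> (nat \<bar>a\<bar>)) else cos (\<theta> (nat \<bar>a\<bar>)))"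
  "Im (edge \<theta> a) = - sin (\<theta> (nat \<bar>a\<bar>))"
  by (auto simp: edge_def)

lemma norm_edge [simp]: "norm (edge \<theta> a) = 1"
  by (simp add: edge_def)

lemma edge_uminus: "a \<noteq> 0 \<Longrightarrow> edge \<theta> (- a) = - cnj (edge \<theta> a)"
  by (simp add: complex_eq_iff edge_Re_Im)

definition labels :: "int set" where "labels = {- 6..6} - {0}"

context
  fixes \<theta> :: "nat \<Rightarrow> real"
  assumes \<theta>: "edge_angles \<theta>"
begin

lemma angle_bounds:
  assumes "a \<in> labels"
  shows "pi / 3 < \<theta> (nat \<bar>a\<bar>)" "\<theta> (nat \<bar>a\<bar>) < pi / 2"
    "0 < sin (\<theta> (nat \<bar>a\<bar>))" "0 < cos (\<theta> (nat \<bar>a\<bar>))"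
proof -
  have "nat \<bar>a\<bar> \<in> {1..6}" using assms by (auto simp: labels_def)
  then show *: "pi / 3 < \<theta> (nat \<bar>a\<bar>)" "\<theta> (nat \<bar>a\<bar>) < pi / 2"
    using \<theta> unfolding edge_angles_def by blast+
  then show "0 < sin (\<theta> (nat \<bar>a\<bar>))" "0 < cos (\<theta> (nat \<bar>a\<bar>))"
    using pi_gt_zero by (intro sin_gt_zero cos_gt_zero_pi; linarith)+
qed

lemma Im_edge_neg: "a \<in> labels \<Longrightarrow> Im (edge \<theta> a) < 0"
  using angle_bounds(3) by (simp add: edge_Re_Im)

text \<open>The last inequality yields the conditions \<open>qa\<close> and \<open>qb\<close> of
  \<open>left_of_four\<close> for two labels of opposite signs, when the upper half of the left path
  goes left along one edge and back right along the other.\<close>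

lemma angle_less:
  assumes "a \<in> labels" "b \<in> labels" "\<bar>b\<bar> < \<bar>a\<bar>"
  defines "A \<equiv> \<theta> (nat \<bar>a\<bar>)" and "B \<equiv> \<theta> (nat \<bar>b\<bar>)"
  shows "sin A < sin B" "cos B < cos A" "2 * cos B * sin B < cos A * sin B + cos B * sin A"
proof -
  have "nat \<bar>a\<bar> \<in> {1..6}" "nat \<bar>b\<bar> \<in> {1..6}" "nat \<bar>b\<bar> < nat \<bar>a\<bar>"
    using assms by (auto simp: labels_def)
  then have "A < B"
    using \<theta> unfolding edge_angles_def A_def B_def monotone_on_def by blast
  have AB: "pi / 3 < A" "A < pi / 2" "pi / 3 < B" "B < pi / 2"
    using assms angle_bounds by auto
  show "sin A < sin B" using AB \<open>A < B\<close> by (intro sin_monotone_2pi) auto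
  show "cos B < cos A" using AB \<open>A < B\<close> by (intro cos_monotone_0_pi) auto
  \<comment> \<open>\<open>sin\<close> decreases between \<open>A + B\<close> and \<open>2 * B\<close>, both being obtuse\<close>
  have "cos (A + B - pi / 2) > cos (2 * B - pi / 2)"
    using AB \<open>A < B\<close> by (intro cos_monotone_0_pi) auto
  then have "sin (2 * B) < sin (A + B)" by (simp add: cos_diff)
  then show "2 * cos B * sin B < cos A * sin B + cos B * sin A"
    unfolding sin_add sin_double by (simp add: mult.commute mult.left_commute)
qed

text \<open>Convexity of the left path: the slope \<open>Re / (- Im)\<close> grows along the labels
  6, ..., 1, -1, ..., -6, so a larger label leans further left. This is why interchanging the edges
  at an ascent moves the path to the right.\<close>

lemma edge_cross:
  assumes "a \<in> labels" "b \<in> labels" "b < a"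
  shows "Re (edge \<theta> a) * - Im (edge \<theta> b) < Re (edge \<theta> b) * - Im (edge \<theta> a)"
proof -
  note pos = angle_bounds(3,4)[OF assms(1)] angle_bounds(3,4)[OF assms(2)]
  have "a \<noteq> 0" "b \<noteq> 0" using assms by (auto simp: labels_def)
  then consider "0 < b" | "b < 0" "0 < a" | "a < 0" using assms by linarith
  then show ?thesis
  proof cases
    case 1
    then show ?thesis
      using assms pos angle_less[OF assms(1,2)] by (auto simp: edge_Re_Im intro: mult_strict_mono)
  next
    case 2
    have "- (cos (\<theta> (nat \<bar>a\<bar>)) * sin (\<theta> (nat \<bar>b\<bar>))) < 0"
      "0 < cos (\<theta> (nat \<bar>b\<bar>)) * sin (\<theta> (nat \<bar>a\<bar>))" using pos by auto
    then show ?thesis using 2 by (auto simp: edge_Re_Im simp del: mult_pos_pos)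
  next
    case 3
    then show ?thesis
      using assms pos angle_less[OF assms(2,1)] by (auto simp: edge_Re_Im intro: mult_strict_mono)
  qed
qed

lemma edge_sum_neg:
  assumes "a \<in> labels" "b \<in> labels" "0 < a + b"
  shows "Re (edge \<theta> a) + Re (edge \<theta> b) < 0"
proof -
  note pos = angle_bounds(3,4)[OF assms(1)] angle_bounds(3,4)[OF assms(2)]
  have "a \<noteq> 0" "b \<noteq> 0" using assms by (auto simp: labels_def)
  then consider "0 < a" "0 < b" | "b < 0" "0 < a" "\<bar>b\<bar> < \<bar>a\<bar>" | "a < 0" "0 < b" "\<bar>a\<bar> < \<bar>b\<bar>"
    using assms by linarith
  then show ?thesis
    by cases (use pos angle_less(2)[OF assms(1,2)] angle_less(2)[OF assms(2,1)] in
        \<open>auto simp: edge_Re_Im\<close>)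
qed

text \<open>Here \<open>a\<close> and \<open>b\<close> stand for the labels in positions 2 and 1
  before a step with \<open>sD 1\<close>; \<open>0 < a + b\<close> is the ascent condition.\<close>

lemma left_of_mega:
  assumes "a \<in> labels" "b \<in> labels" "0 < a + b" "\<bar>a\<bar> \<noteq> \<bar>b\<bar>"
  shows "left_of p [edge \<theta> a, edge \<theta> b, edge \<theta> (- b), edge \<theta> (- a)]
                   [edge \<theta> (- b), edge \<theta> (- a), edge \<theta> a, edge \<theta> b]"
proof -
  define A B where "A = \<theta> (nat \<bar>a\<bar>)" "B = \<theta> (nat \<bar>b\<bar>)"
  note AB = A_B_def[symmetric]
  have ab: "a \<noteq> 0" "b \<noteq> 0" using assms by (auto simp: labels_def)
  have pos: "0 < sin A" "0 < cos A" "0 < sin B" "0 < cos B"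
    using angle_bounds(3,4) assms by (auto simp: A_B_def)
  have less1: "sin A < sin B" "cos B < cos A" "2 * cos B * sin B < cos A * sin B + cos B * sin A"
    if "\<bar>b\<bar> < \<bar>a\<bar>" using angle_less[OF assms(1,2) that] by (auto simp: AB)
  have less2: "sin B < sin A" "cos A < cos B" "2 * cos A * sin A < cos B * sin A + cos A * sin B"
    if "\<bar>a\<bar> < \<bar>b\<bar>" using angle_less[OF assms(2,1) that] by (auto simp: AB)
  have cross: "cos B * sin A < cos A * sin B" if "\<bar>b\<bar> < \<bar>a\<bar>"
    using pos less1[OF that] by (intro mult_strict_mono) auto
  have cross': "cos A * sin B < cos B * sin A" if "\<bar>a\<bar> < \<bar>b\<bar>"
    using pos less2[OF that] by (intro mult_strict_mono) auto
  have pp: "0 < cos A * sin B" "0 < cos B * sin A" "0 < cos A * sin A" "0 < cos B * sin B"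
    using pos by auto
  have mono1: "cos B * sin A \<le> cos B * sin B" if "sin A \<le> sin B" using that pos by auto
  have mono2: "cos A * sin B \<le> cos A * sin A" if "sin B \<le> sin A" using that pos by auto
  consider "0 < a" "0 < b" | "b < 0" "0 < a" "\<bar>b\<bar> < \<bar>a\<bar>" | "a < 0" "0 < b" "\<bar>a\<bar> < \<bar>b\<bar>"
    using assms ab by linarith
  then have
    "Re (edge \<theta> a) * - Im (edge \<theta> b) + Re (edge \<theta> b) * - Im (edge \<theta> a) < 0 \<and>
     (- Im (edge \<theta> a) \<le> - Im (edge \<theta> b) \<longrightarrow> 2 * Re (edge \<theta> b) * - Im (edge \<theta> b) +
        Re (edge \<theta> a) * - Im (edge \<theta> b) - Re (edge \<theta> b) * - Im (edge \<theta> a) < 0) \<and>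
     (- Im (edge \<theta> b) \<le> - Im (edge \<theta> a) \<longrightarrow> 2 * Re (edge \<theta> a) * - Im (edge \<theta> a) +
        Re (edge \<theta> b) * - Im (edge \<theta> a) - Re (edge \<theta> a) * - Im (edge \<theta> b) < 0)"
  proof cases
    case 1
    then show ?thesis using pp mono1 mono2 unfolding edge_Re_Im AB by auto
  next
    case 2
    then show ?thesis using less1 cross unfolding edge_Re_Im AB by auto
  next
    case 3
    then show ?thesis using less2 cross' unfolding edge_Re_Im AB by auto
  qed
  then show ?thesis
    unfolding edge_uminus[OF ab(1)] edge_uminus[OF ab(2)]
    using assms edge_sum_neg Im_edge_neg by (intro left_of_four) auto
qed

end

section \<open>Signed permutations\<close>

text \<open>This is the group of type B; the parity of the number of sign changes, which singles out
  type D, is not recorded.\<close>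

definition signed :: "(int \<Rightarrow> int) \<Rightarrow> bool" where
  "signed r \<longleftrightarrow> r permutes labels \<and> (\<forall>i. r (- i) = - r i)"

lemma signed_id: "signed id"
  by (simp add: signed_def permutes_id)

lemma signed_comp: "signed r \<Longrightarrow> signed s \<Longrightarrow> signed (r \<circ> s)"
  by (auto simp: signed_def intro: permutes_compose)

lemma signed_minus: "signed r \<Longrightarrow> r (- i) = - r i"
  by (simp add: signed_def)

lemma signed_in_labels: "signed r \<Longrightarrow> i \<in> labels \<Longrightarrow> r i \<in> labels"
  by (simp add: signed_def permutes_in_image)

lemma signed_inj: "signed r \<Longrightarrow> r i = r j \<longleftrightarrow> i = j"
  unfolding signed_def by (metis permutes_inj injD)

lemma index_cases:
  assumes "k \<in> {1..6 :: nat}"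
  obtains "k = 1" | "k = 2" | "k = 3" | "k = 4" | "k = 5" | "k = 6"
proof -
  have "k = 1 \<or> k = 2 \<or> k = 3 \<or> k = 4 \<or> k = 5 \<or> k = 6" using assms by auto
  then show ?thesis using that by blast
qed

lemma signed_sD:
  assumes "k \<in> {1..6}"
  shows "signed (sD k)"
proof -
  have "sD k permutes labels"
    using assms unfolding sD_def labels_def
    by (auto intro!: permutes_compose permutes_swap_id)
  moreover have "sD k (- i) = - sD k i" for i
    using assms by (cases k rule: index_cases) (auto simp: sD_def Transposition.transpose_def)
  ultimately show ?thesis by (simp add: signed_def)
qed

lemma sD_sD: "k \<in> {1..6} \<Longrightarrow> sD k \<circ> sD k = id"
  by (cases k rule: index_cases) (auto simp: sD_def Transposition.transpose_def fun_eq_iff)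

lemma sD_commute:
  "sD 2 \<circ> sD 4 = sD 4 \<circ> sD 2" "sD 3 \<circ> sD 5 = sD 5 \<circ> sD 3" "sD 1 \<circ> sD 6 = sD 6 \<circ> sD 1"
  by (auto simp: sD_def Transposition.transpose_def fun_eq_iff)

text \<open>The inverse of the product of the word, built letter by letter. It sends a position on
  the right path to the label there, so a new letter acts on positions, by composition on the
  right.\<close>

definition word_labels :: "nat list \<Rightarrow> int \<Rightarrow> int" where
  "word_labels ks = foldr (\<lambda>k r. r \<circ> sD k) ks id"

lemma word_labels_simps [simp]:
  "word_labels [] = id" "word_labels (k # ks) = word_labels ks \<circ> sD k"
  by (simp_all add: word_labels_def)

lemma word_prod_simps [simp]:
  "word_prod g [] = id" "word_prod g (k # ks) = g k \<circ> word_prod g ks"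
  by (simp_all add: word_prod_def)

lemma word_prod_append: "word_prod g (ks @ ls) = word_prod g ks \<circ> word_prod g ls"
  by (induction ks) (auto simp: comp_assoc)

lemma word_labels_append: "word_labels (ks @ ls) = word_labels ls \<circ> word_labels ks"
  by (induction ks) (auto simp: comp_assoc)

lemma signed_word_labels: "set ks \<subseteq> {1..6} \<Longrightarrow> signed (word_labels ks)"
  by (induction ks) (simp_all add: signed_comp signed_sD signed_id)

lemma word_labels_inverse:
  assumes "set ks \<subseteq> {1..6}"
  shows "word_prod sD ks \<circ> word_labels ks = id" "word_labels ks \<circ> word_prod sD ks = id"
proof -
  have "word_prod sD ks \<circ> word_labels ks = id \<and> word_labels ks \<circ> word_prod sD ks = id"
    using assms
  proof (induction ks)
    case (Cons k ks)
    then have IH: "word_prod sD ks (word_labels ks i) = i" "word_labels ks (word_prod sD ks i) = i"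
      and "sD k (sD k i) = i" for i
      using sD_sD[of k] by (auto simp: fun_eq_iff)
    then show ?case by (auto simp: fun_eq_iff)
  qed simp
  then show "word_prod sD ks \<circ> word_labels ks = id" "word_labels ks \<circ> word_prod sD ks = id"
    by auto
qed

lemma inv_word_prod: "set ks \<subseteq> {1..6} \<Longrightarrow> inv_into UNIV (word_prod sD ks) = word_labels ks"
  using word_labels_inverse by (intro inv_unique_comp)

definition label_path :: "(nat \<Rightarrow> real) \<Rightarrow> (int \<Rightarrow> int) \<Rightarrow> complex list" where
  "label_path \<theta> r = map (\<lambda>i. edge \<theta> (r i)) positions"

lemma B_edges_word: "set ks \<subseteq> {1..6} \<Longrightarrow> B_edges \<theta> (word_prod sD ks) = label_path \<theta> (word_labels ks)"
  by (simp add: B_edges_def label_path_def inv_word_prod)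

lemma B_edges_id: "B_edges \<theta> id = label_path \<theta> id"
  using B_edges_word[of "[]"] by simp

section \<open>Length\<close>

text \<open>Positivity of the \<open>k\<close>-th simple root of type D at the vector of labels; the
  root of \<open>sD 1\<close> is the sum of the first two coordinates. For the inverse
  \<open>r\<close> of \<open>u\<close> it means that \<open>sD k\<close> lengthens
  \<open>u\<close>.\<close>

definition ascent :: "nat \<Rightarrow> (int \<Rightarrow> int) \<Rightarrow> bool" where
  "ascent k r \<longleftrightarrow> (if k = 1 then 0 < r 1 + r 2 else r (int k - 1) < r (int k))"

text \<open>The length function of type D: inversions together with pairs of negative sum.\<close>

fun inversions :: "int list \<Rightarrow> nat" where
  "inversions [] = 0"
| "inversions (a # as) =
     length (filter (\<lambda>b. b < a) as) + length (filter (\<lambda>b. a + b < 0) as) + inversions as"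

lemma inversions_swap:
  "a < b \<Longrightarrow> inversions (xs @ b # a # ys) = Suc (inversions (xs @ a # b # ys))"
  by (induction xs) (auto simp: add.commute)

text \<open>With respect to a later entry, negation exchanges the two kinds of counted pairs, so
  these counts agree in total. Only the sum of the first two entries changes sign.\<close>

lemma inversions_negate:
  "0 < a + b \<Longrightarrow> inversions (- b # - a # ys) = Suc (inversions (a # b # ys))"
proof -
  assume "0 < a + b"
  moreover have "(\<lambda>c. c < - a) = (\<lambda>c. a + c < 0)" "(\<lambda>c. c < - b) = (\<lambda>c. b + c < 0)"
    "(\<lambda>c. - a + c < 0) = (\<lambda>c. c < a)" "(\<lambda>c. - b + c < 0) = (\<lambda>c. c < b)"
    by (auto simp: fun_eq_iff)
  ultimately show ?thesis by simp
qed

definition Dlength :: "(int \<Rightarrow> int) \<Rightarrow> nat" where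
  "Dlength r = inversions (map r [1, 2, 3, 4, 5, 6])"

lemma Dlength_id: "Dlength id = 0"
  by (simp add: Dlength_def)

lemma Dlength_ascent:
  assumes "signed r" "k \<in> {1..6}" "ascent k r"
  shows "Dlength (r \<circ> sD k) = Suc (Dlength r)"
  using assms(2)
proof (cases k rule: index_cases)
  case 1
  then have "map (r \<circ> sD k) [1, 2, 3, 4, 5, 6] = [- r 2, - r 1, r 3, r 4, r 5, r 6]"
    using signed_minus[OF assms(1)] by (simp add: sD_def Transposition.transpose_def)
  then show ?thesis
    using 1 assms(3) inversions_negate unfolding Dlength_def ascent_def by simp
next
  case 2
  then have "map (r \<circ> sD k) [1, 2, 3, 4, 5, 6] = [] @ r 2 # r 1 # [r 3, r 4, r 5, r 6]"
    by (simp add: sD_def Transposition.transpose_def)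
  moreover have "map r [1, 2, 3, 4, 5, 6] = [] @ r 1 # r 2 # [r 3, r 4, r 5, r 6]" by simp
  moreover have "r 1 < r 2" using assms(3) 2 by (simp add: ascent_def)
  ultimately show ?thesis unfolding Dlength_def using inversions_swap by metis
next
  case 3
  then have "map (r \<circ> sD k) [1, 2, 3, 4, 5, 6] = [r 1] @ r 3 # r 2 # [r 4, r 5, r 6]"
    by (simp add: sD_def Transposition.transpose_def)
  moreover have "map r [1, 2, 3, 4, 5, 6] = [r 1] @ r 2 # r 3 # [r 4, r 5, r 6]" by simp
  moreover have "r 2 < r 3" using assms(3) 3 by (simp add: ascent_def)
  ultimately show ?thesis unfolding Dlength_def using inversions_swap by metis
next
  case 4
  then have "map (r \<circ> sD k) [1, 2, 3, 4, 5, 6] = [r 1, r 2] @ r 4 # r 3 # [r 5, r 6]"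
    by (simp add: sD_def Transposition.transpose_def)
  moreover have "map r [1, 2, 3, 4, 5, 6] = [r 1, r 2] @ r 3 # r 4 # [r 5, r 6]" by simp
  moreover have "r 3 < r 4" using assms(3) 4 by (simp add: ascent_def)
  ultimately show ?thesis unfolding Dlength_def using inversions_swap by metis
next
  case 5
  then have "map (r \<circ> sD k) [1, 2, 3, 4, 5, 6] = [r 1, r 2, r 3] @ r 5 # r 4 # [r 6]"
    by (simp add: sD_def Transposition.transpose_def)
  moreover have "map r [1, 2, 3, 4, 5, 6] = [r 1, r 2, r 3] @ r 4 # r 5 # [r 6]" by simp
  moreover have "r 4 < r 5" using assms(3) 5 by (simp add: ascent_def)
  ultimately show ?thesis unfolding Dlength_def using inversions_swap by metis
next
  case 6
  then have "map (r \<circ> sD k) [1, 2, 3, 4, 5, 6] = [r 1, r 2, r 3, r 4] @ r 6 # r 5 # []"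
    by (simp add: sD_def Transposition.transpose_def)
  moreover have "map r [1, 2, 3, 4, 5, 6] = [r 1, r 2, r 3, r 4] @ r 5 # r 6 # []" by simp
  moreover have "r 5 < r 6" using assms(3) 6 by (simp add: ascent_def)
  ultimately show ?thesis unfolding Dlength_def using inversions_swap by metis
qed

lemma ascent_sD:
  assumes "signed r" "k \<in> {1..6}"
  shows "ascent k (r \<circ> sD k) \<longleftrightarrow> \<not> ascent k r"
proof -
  have "r 1 + r 2 \<noteq> 0"
    using signed_inj[OF assms(1), of 2 "-1"] signed_minus[OF assms(1), of 1] by auto
  moreover have "r (int k - 1) \<noteq> r (int k)" using signed_inj[OF assms(1)] by auto
  moreover have "(r \<circ> sD 1) 1 = - r 2" "(r \<circ> sD 1) 2 = - r 1"
    using signed_minus[OF assms(1)] by (simp_all add: sD_def Transposition.transpose_def)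
  moreover have "sD k (int k) = int k - 1" "sD k (int k - 1) = int k" if "k \<noteq> 1"
    using that assms(2) by (auto simp: sD_def Transposition.transpose_def)
  ultimately show ?thesis by (auto simp: ascent_def)
qed

lemma Dlength_descent:
  assumes "signed r" "k \<in> {1..6}" "\<not> ascent k r"
  shows "Dlength r = Suc (Dlength (r \<circ> sD k))"
proof -
  have "signed (r \<circ> sD k)" "ascent k (r \<circ> sD k)" "r \<circ> sD k \<circ> sD k = r"
    using assms signed_comp signed_sD ascent_sD sD_sD by (auto simp: comp_assoc)
  then show ?thesis using Dlength_ascent[of "r \<circ> sD k" k] assms(2) by simp
qed

fun ascending :: "nat list \<Rightarrow> bool" where
  "ascending [] = True"
| "ascending (k # ks) \<longleftrightarrow> ascent k (word_labels ks) \<and> ascending ks"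

text \<open>Every letter changes \<open>Dlength\<close> by exactly one, so equality leaves no room
  for a descent. This turns minimal length into paths that move only to the right.\<close>

lemma Dlength_le_length:
  assumes "set ks \<subseteq> {1..6}"
  shows "Dlength (word_labels ks) \<le> length ks"
    and "Dlength (word_labels ks) = length ks \<Longrightarrow> ascending ks"
proof -
  have "Dlength (word_labels ks) \<le> length ks \<and>
      (Dlength (word_labels ks) = length ks \<longrightarrow> ascending ks)"
    using assms
  proof (induction ks)
    case Nil
    then show ?case by (simp add: Dlength_id del: id_apply)
  next
    case (Cons k ks)
    then have IH: "Dlength (word_labels ks) \<le> length ks"
      "Dlength (word_labels ks) = length ks \<longrightarrow> ascending ks" and k: "k \<in> {1..6}" by auto
    have r: "signed (word_labels ks)" using Cons.prems by (simp add: signed_word_labels)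
    show ?case
    proof (cases "ascent k (word_labels ks)")
      case True
      then show ?thesis using Dlength_ascent[OF r k] IH by (auto simp: o_def)
    next
      case False
      then show ?thesis using Dlength_descent[OF r k] IH by (auto simp: o_def)
    qed
  qed
  then show "Dlength (word_labels ks) \<le> length ks"
    and "Dlength (word_labels ks) = length ks \<Longrightarrow> ascending ks" by auto
qed

section \<open>Tilings of words\<close>

lemma tiles_between_two_swaps:
  assumes T: "tiles_between p es (X @ [a, b] @ Y @ [c, d] @ Z) T"
    and ab: "Im a < 0" "Im b < 0" "Re a * - Im b < Re b * - Im a"
    and cd: "Im c < 0" "Im d < 0" "Re c * - Im d < Re d * - Im c"
  defines "q \<equiv> p + sum_list X"
  defines "q' \<equiv> q + a + b + sum_list Y"
  shows "tiles_between p es (X @ [b, a] @ Y @ [d, c] @ Z)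
    ({enclosed (polyline q [a, b]) (polyline q [b, a]),
      enclosed (polyline q' [c, d]) (polyline q' [d, c])} \<union> T)"
proof -
  have q': "p + sum_list (X @ [b, a] @ Y) = q'" by (simp add: q_def q'_def add_ac)
  have "tiles_between p es ((X @ [b, a] @ Y) @ [c, d] @ Z)
      (insert (enclosed (polyline q [a, b]) (polyline q [b, a])) T)"
    unfolding q_def
    using tiles_between_step[OF T left_of_two[OF ab]] by simp
  from tiles_between_step[OF this left_of_two[OF cd]] show ?thesis
    unfolding q' by (simp add: insert_commute)
qed

lemma step_tiles_one:
  fixes \<theta> :: "nat \<Rightarrow> real" and U :: complex
  assumes "set ks \<subseteq> {1..6}"
  defines "r \<equiv> word_labels ks"
  defines "e \<equiv> \<lambda>i. edge \<theta> (r i)"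
  defines "q \<equiv> U + sum_list [e 6, e 5, e 4, e 3]"
  shows "step_tiles \<theta> U 1 (word_prod sD ks) =
    {enclosed (polyline q [e 2, e 1, e (- 1), e (- 2)]) (polyline q [e (- 1), e (- 2), e 2, e 1])}"
proof -
  have "B_edges \<theta> (word_prod sD ks) = label_path \<theta> r"
    "B_edges \<theta> (sD 1 \<circ> word_prod sD ks) = label_path \<theta> (r \<circ> sD 1)"
    using B_edges_word[of ks] B_edges_word[of "1 # ks"] assms(1) by (simp_all add: r_def)
  then show ?thesis
    unfolding step_tiles_def tile_between_def sub_path_def label_path_def positions_def q_def e_def
    by (simp add: sD_def Transposition.transpose_def)
qed

lemma step_tiles_ge_two:
  fixes \<theta> :: "nat \<Rightarrow> real" and U :: complex
  assumes "set ks \<subseteq> {1..6}" "k \<in> {2..6}"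
  defines "r \<equiv> word_labels ks"
  defines "e \<equiv> \<lambda>i. edge \<theta> (r i)"
  defines "q \<equiv> U + sum_list (map e (take (6 - k) positions))"
  defines "q' \<equiv> U + sum_list (map e (take (4 + k) positions))"
  defines "a \<equiv> e (int k)" and "b \<equiv> e (int k - 1)"
  defines "c \<equiv> e (- (int k - 1))" and "d \<equiv> e (- int k)"
  shows "step_tiles \<theta> U k (word_prod sD ks) =
    {enclosed (polyline q [a, b]) (polyline q [b, a]),
     enclosed (polyline q' [c, d]) (polyline q' [d, c])}"
proof -
  have B: "B_edges \<theta> (word_prod sD ks) = label_path \<theta> r"
    "B_edges \<theta> (sD k \<circ> word_prod sD ks) = label_path \<theta> (r \<circ> sD k)"
    using B_edges_word[of ks] B_edges_word[of "k # ks"] assms(1,2) by (simp_all add: r_def)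
  have "k = 2 \<or> k = 3 \<or> k = 4 \<or> k = 5 \<or> k = 6" using assms(2) by auto
  then show ?thesis
    unfolding step_tiles_def tile_between_def sub_path_def B label_path_def positions_def
      a_def b_def c_def d_def q_def q'_def e_def
    by (elim disjE) (simp_all add: sD_def Transposition.transpose_def add_ac)
qed

context
  fixes \<theta> :: "nat \<Rightarrow> real"
  assumes \<theta>: "edge_angles \<theta>"
begin

lemma left_of_ascent_one:
  assumes r: "signed r" and asc: "ascent 1 r"
  shows "left_of q [edge \<theta> (r 2), edge \<theta> (r 1), edge \<theta> (r (- 1)), edge \<theta> (r (- 2))]
    [edge \<theta> (r (- 1)), edge \<theta> (r (- 2)), edge \<theta> (r 2), edge \<theta> (r 1)]"
proof -
  have labs: "r 1 \<in> labels" "r 2 \<in> labels"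
    by (rule signed_in_labels[OF r]; simp add: labels_def)+
  have "r 2 \<noteq> r 1" "r 2 \<noteq> r (- 1)" using signed_inj[OF r] by simp_all
  then have "\<bar>r 2\<bar> \<noteq> \<bar>r 1\<bar>" using signed_minus[OF r, of 1] by linarith
  moreover have "0 < r 2 + r 1" using asc by (simp add: ascent_def)
  ultimately show ?thesis
    unfolding signed_minus[OF r] using left_of_mega[OF \<theta> labs(2,1)] by simp
qed

lemma left_of_ascent_ge_two:
  assumes r: "signed r" and asc: "ascent k r" and k: "k \<in> {2..6}"
  shows "left_of q [edge \<theta> (r (int k)), edge \<theta> (r (int k - 1))]
    [edge \<theta> (r (int k - 1)), edge \<theta> (r (int k))]"
proof -
  have "r (int k) \<in> labels" "r (int k - 1) \<in> labels"
    by (rule signed_in_labels[OF r]; use k in \<open>auto simp: labels_def\<close>)+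
  moreover have "r (int k - 1) < r (int k)" using asc k by (auto simp: ascent_def)
  ultimately show ?thesis using edge_cross[OF \<theta>] Im_edge_neg[OF \<theta>] by (intro left_of_two)
qed

lemma step_tiles_tiling:
  assumes ks: "set ks \<subseteq> {1..6}" and k: "k \<in> {1..6}" and asc: "ascent k (word_labels ks)"
    and T: "tiles_between U es (label_path \<theta> (word_labels ks)) T"
  shows "tiles_between U es (label_path \<theta> (word_labels (k # ks)))
      (step_tiles \<theta> U k (word_prod sD ks) \<union> T)" (is ?A)
    and "\<forall>R \<in> step_tiles \<theta> U k (word_prod sD ks). rhombus R \<or> megatile R" (is ?B)
proof -
  define r where "r = word_labels ks"
  define e where "e = (\<lambda>i. edge \<theta> (r i))"
  have r: "signed r" using ks by (simp add: r_def signed_word_labels)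
  have lab: "r i \<in> labels" if "i \<in> labels" for i using signed_in_labels[OF r that] .
  have path: "label_path \<theta> r = map e positions" by (simp add: label_path_def e_def)
  have e_minus: "e (- i) = edge \<theta> (- r i)" for i by (simp add: e_def signed_minus[OF r])
  have "?A \<and> ?B"
  proof (cases "k = 1")
    case True
    define q where "q = U + sum_list [e 6, e 5, e 4, e 3]"
    let ?E = "[e 2, e 1, e (- 1), e (- 2)]" and ?F = "[e (- 1), e (- 2), e 2, e 1]"
    have labs: "r 1 \<in> labels" "r 2 \<in> labels" by (rule lab; simp add: labels_def)+
    have asc1: "ascent 1 r" using asc True by (simp add: r_def)
    then have sum: "0 < r 2 + r 1" by (simp add: ascent_def)
    have left: "left_of q ?E ?F" for q
      unfolding e_def by (rule left_of_ascent_one[OF r asc1])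
    have S: "step_tiles \<theta> U k (word_prod sD ks) = {enclosed (polyline q ?E) (polyline q ?F)}"
      using step_tiles_one[OF ks, of \<theta> U] True by (simp add: q_def e_def r_def)
    have new: "label_path \<theta> (word_labels (k # ks)) =
        [e 6, e 5, e 4, e 3] @ ?F @ [e (- 3), e (- 4), e (- 5), e (- 6)]"
      using True by (simp add: label_path_def positions_def sD_def Transposition.transpose_def
          e_def r_def)
    have old: "label_path \<theta> (word_labels ks) =
        [e 6, e 5, e 4, e 3] @ ?E @ [e (- 3), e (- 4), e (- 5), e (- 6)]"
      by (simp add: label_path_def positions_def e_def r_def)
    have ?A
      using tiles_between_step[OF T[unfolded old] left] unfolding new S q_def by simp
    moreover have ?B
    proof -
      have "r 1 \<noteq> 0" "r 2 \<noteq> 0" using labs by (auto simp: labels_def)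
      then have m: "e (- 1) = - cnj (e 1)" "e (- 2) = - cnj (e 2)"
        unfolding e_minus by (simp_all add: e_def edge_uminus)
      have "Re (e 2) + Re (e 1) < 0" "Im (e 2) < 0" "Im (e 1) < 0"
        using edge_sum_neg[OF \<theta> labs(2,1) sum] Im_edge_neg[OF \<theta>] labs by (simp_all add: e_def)
      then have "megatile (enclosed (polyline q ?E) (polyline q ?F))"
        unfolding m using left[of q, unfolded m]
        by (intro megatile_enclosed) (simp_all add: e_def)
      then show ?thesis unfolding S by simp
    qed
    ultimately show ?thesis by blast
  next
    case False
    then have k2: "k \<in> {2..6}" using k by auto
    define a b c d where "a = e (int k)" and "b = e (int k - 1)"
      and "c = e (- (int k - 1))" and "d = e (- int k)"
    \<comment> \<open>Counting from 0, position \<open>k\<close> has index \<open>6 - k\<close> and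
      position \<open>-(k - 1)\<close> has index \<open>4 + k\<close>. Hence the
      \<open>2 * k - 4\<close> edges of \<open>Y\<close> start at index \<open>8 - k\<close>, and
      \<open>Z\<close> starts at \<open>6 + k\<close>.\<close>
    define X where "X = map e (take (6 - k) positions)"
    define Y where "Y = map e (take (2 * k - 4) (drop (8 - k) positions))"
    define Z where "Z = map e (drop (6 + k) positions)"
    define q where "q = U + sum_list X"
    define q' where "q' = U + sum_list (map e (take (4 + k) positions))"
    have cases: "k = 2 \<or> k = 3 \<or> k = 4 \<or> k = 5 \<or> k = 6" using k2 by auto
    have labs: "r (int k) \<in> labels" "r (int k - 1) \<in> labels"
      by (rule lab; use k2 in \<open>auto simp: labels_def\<close>)+
    then have labs': "- r (int k) \<in> labels" "- r (int k - 1) \<in> labels" by (auto simp: labels_def)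
    have less: "r (int k - 1) < r (int k)" using asc False by (simp add: ascent_def r_def)
    have cd: "c = edge \<theta> (- r (int k - 1))" "d = edge \<theta> (- r (int k))"
      unfolding c_def d_def e_minus by simp_all
    have ab: "a = edge \<theta> (r (int k))" "b = edge \<theta> (r (int k - 1))"
      by (simp_all add: a_def b_def e_def)
    have Im: "Im a < 0" "Im b < 0" "Im c < 0" "Im d < 0"
      unfolding ab cd using labs labs' Im_edge_neg[OF \<theta>] by auto
    have crossab: "Re a * - Im b < Re b * - Im a"
      unfolding ab using edge_cross[OF \<theta> labs less] .
    have crosscd: "Re c * - Im d < Re d * - Im c"
      unfolding cd using edge_cross[OF \<theta> labs'(2,1)] less by simp
    have S: "step_tiles \<theta> U k (word_prod sD ks) =
      {enclosed (polyline q [a, b]) (polyline q [b, a]),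
       enclosed (polyline q' [c, d]) (polyline q' [d, c])}"
      using step_tiles_ge_two[OF ks k2, of \<theta> U]
      unfolding a_def b_def c_def d_def q_def q'_def X_def e_def r_def .
    have old: "label_path \<theta> (word_labels ks) = X @ [a, b] @ Y @ [c, d] @ Z"
      using cases unfolding r_def[symmetric] path
      by (elim disjE) (simp_all add: X_def Y_def Z_def a_def b_def c_def d_def positions_def)
    have new: "label_path \<theta> (word_labels (k # ks)) = X @ [b, a] @ Y @ [d, c] @ Z"
      using cases unfolding label_path_def
      by (elim disjE) (simp_all add: X_def Y_def Z_def a_def b_def c_def d_def positions_def
          sD_def Transposition.transpose_def e_def r_def)
    have q': "q' = q + a + b + sum_list Y"
      using cases by (elim disjE) (simp_all add: q_def q'_def X_def Y_def a_def b_def positions_def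
          add_ac)
    have ?A
      unfolding new S q' unfolding q_def
      using tiles_between_two_swaps[OF T[unfolded old] Im(1,2) crossab Im(3,4) crosscd] .
    moreover have ?B
      unfolding S using rhombus_enclosed[OF _ _ Im(1,2) crossab] rhombus_enclosed[OF _ _ Im(3,4) crosscd]
      by (simp add: ab cd)
    ultimately show ?thesis by blast
  qed
  then show ?A ?B by auto
qed

lemma down_label_path: "signed r \<Longrightarrow> down (label_path \<theta> r)"
  unfolding down_def label_path_def
  using Im_edge_neg[OF \<theta>] signed_in_labels[of r] by (auto simp: positions_def labels_def)

lemma word_tiling_tiles:
  assumes "set ks \<subseteq> {1..6}" "ascending ks"
  shows "tiles_between U (label_path \<theta> id) (label_path \<theta> (word_labels ks)) (word_tiling \<theta> U ks) \<and>
    (\<forall>R \<in> word_tiling \<theta> U ks. rhombus R \<or> megatile R)" (is "?P ks")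
  using assms
proof (induction ks)
  case Nil
  then show ?case using tiles_between_refl[OF down_label_path[OF signed_id]] by (simp add: id_def)
next
  case (Cons k ks)
  then have ks: "set ks \<subseteq> {1..6}" "k \<in> {1..6}" "ascent k (word_labels ks)" and P: "?P ks" by auto
  have "?P (k # ks)"
    unfolding word_tiling.simps
    using step_tiles_tiling[OF ks conjunct1[OF P]] conjunct2[OF P] by blast
  then show ?case .
qed

lemma word_tiling_tiling_of:
  assumes "set ks \<subseteq> {1..6}" "ascending ks"
  shows "tiling_of (Y_polygon \<theta> U (word_prod sD ks)) (word_tiling \<theta> U ks)"
  using tiling_of_enclosed[of U "label_path \<theta> id" "label_path \<theta> (word_labels ks)"]
    word_tiling_tiles[OF assms]
  by (simp add: Y_polygon_def B_path_def B_edges_word[OF assms(1)] B_edges_id)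

end

section \<open>The subgroup of type H3\<close>

definition golden :: real where
  "golden = (1 + sqrt 5) / 2"

lemma golden_square: "golden * golden = golden + 1"
  by (simp add: golden_def field_simps)

lemma golden_gt_one: "1 < golden"
proof -
  have "sqrt 1 < sqrt 5" by (subst real_sqrt_less_iff) simp
  then show ?thesis by (simp add: golden_def)
qed

text \<open>A vector in the three-dimensional \<open>X\<close>-invariant subspace that is cut out by
  the relations in \<open>golden_labels\<close> and on which the simple roots take the values \<open>2\<close> and
  \<open>2 * golden\<close>.\<close>

definition weight :: "int \<Rightarrow> real" where
  "weight a = of_int (sgn a) * ([0, golden - 1, golden + 1, 3 * golden + 1, 5 * golden + 1,
     5 * golden + 3, 5 * golden + 5] ! nat \<bar>a\<bar>)"

lemma weight_minus: "weight (- a) = - weight a"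
  by (simp add: weight_def)

lemma weight_values:
  "weight 1 = golden - 1" "weight 2 = golden + 1" "weight 3 = 3 * golden + 1"
  "weight 4 = 5 * golden + 1" "weight 5 = 5 * golden + 3" "weight 6 = 5 * golden + 5"
  by (simp_all add: weight_def)

text \<open>The first weight is positive because \<open>golden > 1\<close>, and neighbouring weights
  increase by 2 or \<open>2 * golden\<close>. Ascents can therefore be tested on weights.\<close>

lemma weight_less:
  assumes "a \<in> labels" "b \<in> labels" "a < b"
  shows "weight a < weight b"
proof -
  have pos: "0 < weight c" if "1 \<le> c" "c \<le> 6" for c
  proof -
    have "c = 1 \<or> c = 2 \<or> c = 3 \<or> c = 4 \<or> c = 5 \<or> c = 6" using that by linarith
    then show ?thesis using golden_gt_one by (auto simp: weight_values)
  qed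
  have mono: "weight c < weight d" if "1 \<le> c" "c < d" "d \<le> 6" for c d
  proof -
    have "c = 1 \<or> c = 2 \<or> c = 3 \<or> c = 4 \<or> c = 5"
      "d = 2 \<or> d = 3 \<or> d = 4 \<or> d = 5 \<or> d = 6" using that by linarith+
    then show ?thesis using that golden_gt_one by (auto simp: weight_values)
  qed
  consider "0 < a" | "b < 0" | "a < 0" "0 < b" using assms by (fastforce simp: labels_def)
  then show ?thesis
  proof cases
    case 1
    then show ?thesis using mono[of a b] assms by (auto simp: labels_def)
  next
    case 2
    then show ?thesis using mono[of "- b" "- a"] assms by (auto simp: labels_def weight_minus)
  next
    case 3
    then show ?thesis using pos[of "- a"] pos[of b] assms by (auto simp: labels_def weight_minus)
  qed
qed

lemma weight_less_iff: "a \<in> labels \<Longrightarrow> b \<in> labels \<Longrightarrow> weight a < weight b \<longleftrightarrow> a < b"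
  using weight_less by (metis less_irrefl linorder_neqE less_asym)

text \<open>At the weights of the labels, the simple roots 4, 3, 1 are \<open>golden\<close> times
  their partners 2, 5, 6.\<close>

definition golden_labels :: "(int \<Rightarrow> int) \<Rightarrow> bool" where
  "golden_labels r \<longleftrightarrow> signed r \<and>
     weight (r 4) - weight (r 3) = golden * (weight (r 2) - weight (r 1)) \<and>
     weight (r 3) - weight (r 2) = golden * (weight (r 5) - weight (r 4)) \<and>
     weight (r 1) + weight (r 2) = golden * (weight (r 6) - weight (r 5))"

lemma golden_labels_id: "golden_labels id"
  using golden_square by (simp add: golden_labels_def signed_id weight_values)

lemma golden_labels_comp:
  assumes "golden_labels r"
  shows "golden_labels (r \<circ> sD 4 \<circ> sD 2)" "golden_labels (r \<circ> sD 5 \<circ> sD 3)"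
    "golden_labels (r \<circ> sD 6 \<circ> sD 1)"
proof -
  define C where "C = (\<lambda>i. weight (r i))"
  have r: "signed r"
    and C: "C 4 - C 3 = golden * (C 2 - C 1)" "C 3 - C 2 = golden * (C 5 - C 4)"
      "C 1 + C 2 = golden * (C 6 - C 5)"
    using assms by (auto simp: golden_labels_def C_def)
  have sq: "golden * (golden * z) = golden * z + z" for z
    by (simp add: golden_square distrib_right flip: mult.assoc)
  \<comment> \<open>The relations multiplied by \<open>golden\<close>, with the square eliminated.
    With these, \<open>C i\<close> and \<open>golden * C i\<close> can be treated as separate
    unknowns and the remaining goals become linear.\<close>
  have sq': "golden * (C 4 - C 3) = (C 4 - C 3) + (C 2 - C 1)"
    "golden * (C 3 - C 2) = (C 3 - C 2) + (C 5 - C 4)"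
    "golden * (C 1 + C 2) = (C 1 + C 2) + (C 6 - C 5)"
    unfolding C sq by simp_all
  have dist: "golden * (x + y) = golden * x + golden * y"
    "golden * (x - y) = golden * x - golden * y" for x y
    by (simp_all add: algebra_simps)
  note C' = C[unfolded dist] sq'[unfolded dist]
  note simps = golden_labels_def sD_def Transposition.transpose_def dist signed_minus[OF r]
    weight_minus
  have s: "signed (r \<circ> sD a \<circ> sD b)" if "a \<in> {1..6}" "b \<in> {1..6}" for a b
    using that by (intro signed_comp r signed_sD)
  show "golden_labels (r \<circ> sD 4 \<circ> sD 2)"
    using s[of 4 2] C' unfolding C_def by (simp add: simps)
  show "golden_labels (r \<circ> sD 5 \<circ> sD 3)"
    using s[of 5 3] C' unfolding C_def by (simp add: simps)
  show "golden_labels (r \<circ> sD 6 \<circ> sD 1)"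
    using s[of 6 1] C' unfolding C_def by (simp add: simps)
qed

lemma golden_ascents:
  assumes "golden_labels r"
  shows "ascent 2 r \<longleftrightarrow> ascent 4 r" "ascent 3 r \<longleftrightarrow> ascent 5 r" "ascent 1 r \<longleftrightarrow> ascent 6 r"
proof -
  have r: "signed r" using assms by (simp add: golden_labels_def)
  have lab: "r i \<in> labels" if "i \<in> labels" for i using signed_in_labels[OF r that] .
  have labs: "r 1 \<in> labels" "r 2 \<in> labels" "r 3 \<in> labels" "r 4 \<in> labels" "r 5 \<in> labels"
    "r 6 \<in> labels"
    by (rule lab; simp add: labels_def)+
  then have labs': "- r 1 \<in> labels" by (auto simp: labels_def)
  have asc: "ascent 1 r \<longleftrightarrow> 0 < weight (r 1) + weight (r 2)"
    "ascent 2 r \<longleftrightarrow> 0 < weight (r 2) - weight (r 1)"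
    "ascent 3 r \<longleftrightarrow> 0 < weight (r 3) - weight (r 2)"
    "ascent 4 r \<longleftrightarrow> 0 < weight (r 4) - weight (r 3)"
    "ascent 5 r \<longleftrightarrow> 0 < weight (r 5) - weight (r 4)"
    "ascent 6 r \<longleftrightarrow> 0 < weight (r 6) - weight (r 5)"
    using weight_less_iff[of "- r 1" "r 2"] labs labs'
    by (auto simp: ascent_def weight_less_iff weight_minus)
  show "ascent 2 r \<longleftrightarrow> ascent 4 r" "ascent 3 r \<longleftrightarrow> ascent 5 r" "ascent 1 r \<longleftrightarrow> ascent 6 r"
    using assms golden_gt_one unfolding asc golden_labels_def by (auto simp: zero_less_mult_iff)
qed

section \<open>Blocks of two commuting letters\<close>

definition block :: "nat \<Rightarrow> nat list" where
  "block j = (if j = 1 then [2, 4] else if j = 2 then [3, 5] else [1, 6])"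

lemma block_eqs: "block 1 = [2, 4]" "block 2 = [3, 5]" "block 3 = [1, 6]"
  by (simp_all add: block_def)

lemma set_block: "set (block j) \<subseteq> {1..6}"
  by (auto simp: block_def)

lemma T_index_cases:
  assumes "j \<in> {1..3 :: nat}"
  obtains "j = 1" | "j = 2" | "j = 3"
proof -
  have "j = 1 \<or> j = 2 \<or> j = 3" using assms by auto
  then show ?thesis using that by blast
qed

lemma golden_labels_block: "golden_labels r \<Longrightarrow> golden_labels (r \<circ> word_labels (block j))"
  using golden_labels_comp[of r] by (auto simp: block_def comp_assoc)

lemma word_prod_block: "word_prod sD (block j) = tH j"
  by (auto simp: block_def tH_def)

lemma word_labels_block: "word_labels (block j) = tH j"
  using sD_commute by (auto simp: block_def tH_def)

lemma tH_tH: "tH j \<circ> tH j = id"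
proof -
  obtain a b where ab: "tH j = sD a \<circ> sD b" "sD a \<circ> sD b = sD b \<circ> sD a" "a \<in> {1..6}" "b \<in> {1..6}"
    using sD_commute by (cases "j = 1"; cases "j = 2") (force simp: tH_def)+
  have "sD a (sD b i) = sD b (sD a i)" "sD a (sD a i) = i" "sD b (sD b i) = i" for i
    using ab(2) sD_sD[OF ab(3)] sD_sD[OF ab(4)] by (simp_all add: fun_eq_iff)
  then show ?thesis by (simp add: fun_eq_iff ab(1))
qed

text \<open>The two letters of a block act on disjoint positions.\<close>

lemma ascent_commute:
  assumes "(a, b) \<in> {(2, 4), (3, 5), (1, 6)}"
  shows "ascent a (r \<circ> sD b) \<longleftrightarrow> ascent a r"
  using assms by (auto simp: ascent_def sD_def Transposition.transpose_def)

lemma block_pair: "\<exists>a b. block j = [a, b] \<and> (a, b) \<in> {(2, 4), (3, 5), (1, 6)}"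
  by (auto simp: block_def)

text \<open>By \<open>golden_ascents\<close> both letters go up or both go down at \<open>r\<close>,
  and by \<open>ascent_commute\<close> applying one does not affect the other.\<close>

lemma Dlength_block:
  assumes "golden_labels r" "block j = [a, b]"
  shows "ascent b r \<Longrightarrow> Dlength (r \<circ> word_labels (block j)) = Dlength r + 2"
    and "\<not> ascent b r \<Longrightarrow> Dlength r = Dlength (r \<circ> word_labels (block j)) + 2"
proof -
  have r: "signed r" using assms(1) by (simp add: golden_labels_def)
  have ab: "(a, b) \<in> {(2, 4), (3, 5), (1, 6)}" using assms(2) block_pair[of j] by auto
  then have k: "a \<in> {1..6}" "b \<in> {1..6}" by auto
  have "ascent a r \<longleftrightarrow> ascent b r" using ab golden_ascents[OF assms(1)] by auto
  then have asc: "ascent a (r \<circ> sD b) \<longleftrightarrow> ascent b r" using ascent_commute[OF ab] by simp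
  have eq: "r \<circ> word_labels (block j) = r \<circ> sD b \<circ> sD a" using assms(2) by (simp add: comp_assoc)
  have s: "signed (r \<circ> sD b)" by (intro signed_comp r signed_sD k)
  show "Dlength (r \<circ> word_labels (block j)) = Dlength r + 2" if "ascent b r"
    unfolding eq using that asc Dlength_ascent[OF r k(2)] Dlength_ascent[OF s k(1)] by simp
  show "Dlength r = Dlength (r \<circ> word_labels (block j)) + 2" if "\<not> ascent b r"
    unfolding eq using that asc Dlength_descent[OF r k(2)] Dlength_descent[OF s k(1)] by simp
qed

lemma golden_labels_no_descent:
  assumes "golden_labels r" and asc: "\<And>k. k \<in> {1..6} \<Longrightarrow> ascent k r"
  shows "r = id"
proof -
  have r: "signed r" using assms by (simp add: golden_labels_def)
  have lab: "r i \<in> labels" if "i \<in> labels" for i using signed_in_labels[OF r that] .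
  have labs: "r 1 \<in> labels" "r 2 \<in> labels" "r 6 \<in> labels" by (rule lab; simp add: labels_def)+
  have inc: "0 < r 1 + r 2" "r 1 < r 2" "r 2 < r 3" "r 3 < r 4" "r 4 < r 5" "r 5 < r 6"
    using asc[of 1] asc[of 2] asc[of 3] asc[of 4] asc[of 5] asc[of 6] by (simp_all add: ascent_def)
  have bounds: "r 6 \<le> 6" "r 1 \<noteq> 0" using labs by (auto simp: labels_def)
  have high: "r 2 = 2" "r 3 = 3" "r 4 = 4" "r 5 = 5" "r 6 = 6" "r 1 = 1 \<or> r 1 = - 1"
    using inc bounds by linarith+
  \<comment> \<open>Ascents alone do not exclude a single sign change at 1, which has the wrong
    parity for type D. The third golden relation does: it would read
    \<open>2 = golden * 2\<close>.\<close>
  have "r 1 \<noteq> - 1"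
  proof
    assume "r 1 = - 1"
    then have "weight (r 1) + weight (r 2) = 2" "weight (r 6) - weight (r 5) = 2"
      by (simp_all add: high weight_minus weight_values)
    then show False using assms(1) golden_gt_one by (simp add: golden_labels_def)
  qed
  then have "r 1 = 1" using high by blast
  have pos: "r i = i" if "1 \<le> i" "i \<le> 6" for i
  proof -
    have "i = 1 \<or> i = 2 \<or> i = 3 \<or> i = 4 \<or> i = 5 \<or> i = 6" using that by linarith
    then show ?thesis using high \<open>r 1 = 1\<close> by auto
  qed
  have "r i = i" for i
  proof (cases "i \<in> labels")
    case True
    then show ?thesis
      using pos[of i] pos[of "- i"] signed_minus[OF r, of i] by (cases "0 < i") (auto simp: labels_def)
  next
    case False
    have "r permutes labels" using r by (simp add: signed_def)
    then show ?thesis using False by (rule permutes_not_in)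
  qed
  then show ?thesis by (simp add: fun_eq_iff)
qed

section \<open>Expansion of words and minimal lengths over both generating sets\<close>

definition expand :: "nat list \<Rightarrow> nat list" where
  "expand js = concat (map block js)"

lemma expand_simps [simp]:
  "expand [] = []" "expand (j # js) = block j @ expand js" "expand (js @ ls) = expand js @ expand ls"
  by (simp_all add: expand_def)

lemma set_expand: "set (expand js) \<subseteq> {1..6}"
  using set_block by (fastforce simp: expand_def)

lemma length_expand: "length (expand js) = 2 * length js"
  by (induction js) (auto simp: block_def)

lemma word_prod_expand: "word_prod sD (expand js) = word_prod tH js"
  by (induction js) (simp_all add: word_prod_append word_prod_block)

lemma golden_labels_expand: "golden_labels (word_labels (expand js))" (is "?P js")
proof (induction js)
  case Nil
  have "?P []" by (simp only: expand_simps word_labels_simps golden_labels_id)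
  then show ?case .
next
  case (Cons j js)
  have "?P (j # js)"
    unfolding expand_simps word_labels_append by (rule golden_labels_block[OF Cons])
  then show ?case .
qed

text \<open>If a generator \<open>s\<^sub>i\<close> shortens an element of \<open>X\<close>, then so does the generator in the same block, hence
  greedy descent reaches the identity in steps of \<open>D\<close>-length two.\<close>

lemma golden_labels_word:
  assumes "golden_labels r"
  shows "\<exists>js. set js \<subseteq> {1..3} \<and> word_labels (expand js) = r \<and> 2 * length js = Dlength r"
  using assms
proof (induction "Dlength r" arbitrary: r rule: less_induct)
  case less
  show ?case
  proof (cases "r = id")
    case True
    then show ?thesis by (intro exI[of _ "[]"]) (simp add: Dlength_id)
  next
    case False
    then obtain k where k: "k \<in> {1..6}" "\<not> ascent k r"
      using golden_labels_no_descent[OF less.prems] by blast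
    have "\<exists>j a b. j \<in> {1..3} \<and> block j = [a, b] \<and> \<not> ascent b r"
      using k(1)
    proof (cases k rule: index_cases)
      case 1
      with k golden_ascents[OF less.prems] show ?thesis by - (rule exI[of _ 3], simp add: block_def)
    next
      case 2
      with k golden_ascents[OF less.prems] show ?thesis by - (rule exI[of _ 1], simp add: block_def)
    next
      case 3
      with k golden_ascents[OF less.prems] show ?thesis by - (rule exI[of _ 2], simp add: block_def)
    next
      case 4
      with k golden_ascents[OF less.prems] show ?thesis by - (rule exI[of _ 1], simp add: block_def)
    next
      case 5
      with k golden_ascents[OF less.prems] show ?thesis by - (rule exI[of _ 2], simp add: block_def)
    next
      case 6
      with k golden_ascents[OF less.prems] show ?thesis by - (rule exI[of _ 3], simp add: block_def)
    qed
    then obtain j a b where j: "j \<in> {1..3}" "block j = [a, b]" "\<not> ascent b r" by blast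
    let ?r = "r \<circ> word_labels (block j)"
    have len: "Dlength r = Dlength ?r + 2" using Dlength_block(2)[OF less.prems j(2,3)] .
    then obtain js where js: "set js \<subseteq> {1..3}" "word_labels (expand js) = ?r"
      "2 * length js = Dlength ?r"
      using less.hyps[of ?r] golden_labels_block[OF less.prems] by auto
    have "word_labels (expand (j # js)) = r"
      by (simp add: word_labels_append js comp_assoc word_labels_block tH_tH)
    then show ?thesis using js j len by (intro exI[of _ "j # js"]) simp
  qed
qed

lemma word_prod_eq_iff:
  assumes "set ks \<subseteq> {1..6}" "set ls \<subseteq> {1..6}"
  shows "word_prod sD ks = word_prod sD ls \<longleftrightarrow> word_labels ks = word_labels ls"
  using word_labels_inverse[OF assms(1)] word_labels_inverse[OF assms(2)]
  by (metis comp_assoc comp_id id_comp)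

lemma reduced_words_eqI:
  assumes "ls \<in> words_for I g w" "\<And>ks. ks \<in> words_for I g w \<Longrightarrow> length ls \<le> length ks"
  shows "reduced_words I g w = {ks \<in> words_for I g w. length ks = length ls}"
  using assms unfolding reduced_words_def by (auto intro: antisym)

text \<open>The word \<open>js\<close> need not be reduced; it only names an element of X.
  \<open>Dlength\<close> bounds the length of every word for it from below, and the expansion of the
  word found by greedy descent attains the bound.\<close>

lemma S_reduced_words_expand:
  "S_reduced_words (word_prod tH js) =
    {ks \<in> words_for {1..6} sD (word_prod tH js). length ks = Dlength (word_labels (expand js))}"
proof -
  let ?n = "Dlength (word_labels (expand js))"
  obtain js' where js': "word_labels (expand js') = word_labels (expand js)" "2 * length js' = ?n"
    using golden_labels_word[OF golden_labels_expand] by blast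
  have mem: "expand js' \<in> words_for {1..6} sD (word_prod tH js)"
    using js' set_expand word_prod_eq_iff[OF set_expand set_expand]
    by (auto simp: words_for_def simp flip: word_prod_expand)
  have lower: "?n \<le> length ks" if "ks \<in> words_for {1..6} sD (word_prod tH js)" for ks
  proof -
    have ks: "set ks \<subseteq> {1..6}" "word_prod sD ks = word_prod sD (expand js)"
      using that by (auto simp: words_for_def word_prod_expand)
    then have "word_labels ks = word_labels (expand js)"
      using word_prod_eq_iff[OF ks(1) set_expand] by simp
    then show ?thesis using Dlength_le_length(1)[OF ks(1)] by simp
  qed
  have len: "length (expand js') = ?n" using js' length_expand by simp
  show ?thesis
    unfolding S_reduced_words_def len[symmetric] using mem lower unfolding len[symmetric]
    by (rule reduced_words_eqI)
qed

lemma T_reduced_words_expand: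
  "T_reduced_words (word_prod tH js) =
    {ks \<in> words_for {1..3} tH (word_prod tH js). 2 * length ks = Dlength (word_labels (expand js))}"
proof -
  let ?n = "Dlength (word_labels (expand js))"
  obtain js' where js': "set js' \<subseteq> {1..3}" "word_labels (expand js') = word_labels (expand js)"
    "2 * length js' = ?n"
    using golden_labels_word[OF golden_labels_expand] by blast
  have mem: "js' \<in> words_for {1..3} tH (word_prod tH js)"
    using js' word_prod_eq_iff[OF set_expand set_expand]
    by (auto simp: words_for_def simp flip: word_prod_expand)
  have lower: "?n \<le> 2 * length ks" if "ks \<in> words_for {1..3} tH (word_prod tH js)" for ks
  proof -
    have "word_prod sD (expand ks) = word_prod sD (expand js)"
      using that by (auto simp: words_for_def word_prod_expand)
    then have "word_labels (expand ks) = word_labels (expand js)"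
      using word_prod_eq_iff[OF set_expand set_expand] by simp
    then show ?thesis using Dlength_le_length(1)[OF set_expand, of ks] by (simp add: length_expand)
  qed
  have len: "2 * length ks = ?n \<longleftrightarrow> length ks = length js'" for ks :: "nat list"
    using js'(3) by auto
  have "length js' \<le> length ks" if "ks \<in> words_for {1..3} tH (word_prod tH js)" for ks
    using lower[OF that] js'(3) by auto
  with mem show ?thesis unfolding T_reduced_words_def len by (rule reduced_words_eqI)
qed

lemma X_H3_word:
  assumes "x \<in> X_H3"
  shows "\<exists>js. set js \<subseteq> {1..3} \<and> x = word_prod tH js"
proof -
  have mult: "mult W_D6 = (\<circ>)" and one: "one W_D6 = id"
    by (simp_all add: W_D6_def Sym12_def)
  have carrier: "tH j \<in> carrier W_D6" for j
  proof -
    have "word_prod sD (block j) \<in> generate Sym12 (sD ` {1..6})"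
    proof -
      obtain a b where ab: "block j = [a, b]" "a \<in> {1..6}" "b \<in> {1..6}"
        using block_pair[of j] by auto
      have "sD a \<otimes>\<^bsub>Sym12\<^esub> sD b \<in> generate Sym12 (sD ` {1..6})"
        using ab by (intro generate.eng generate.incl) auto
      then show ?thesis using ab by (simp add: Sym12_def)
    qed
    then show ?thesis by (simp add: W_D6_def word_prod_block)
  qed
  \<comment> \<open>The inverse is a definite description, which \<open>tH_tH\<close> and
    associativity of composition determine directly.\<close>
  have inv: "m_inv W_D6 (tH j) = tH j" if "j \<in> {1..3}" for j
  proof -
    show ?thesis
      unfolding m_inv_def mult one
    proof (rule the_equality)
      show "tH j \<in> carrier W_D6 \<and> tH j \<circ> tH j = id \<and> tH j \<circ> tH j = id"
        using carrier tH_tH by blast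
      fix y assume "y \<in> carrier W_D6 \<and> tH j \<circ> y = id \<and> y \<circ> tH j = id"
      then show "y = tH j" using tH_tH by (metis comp_assoc comp_id id_comp)
    qed
  qed
  have gen: "\<exists>js. set js \<subseteq> {1..3} \<and> tH j = word_prod tH js" if "j \<in> {1..3}" for j
    using that by (intro exI[of _ "[j]"]) auto
  show ?thesis
    using assms unfolding X_H3_def
  proof (induction rule: generate.induct)
    case one
    then show ?case by (intro exI[of _ "[]"]) (simp add: W_D6_def Sym12_def)
  next
    case (incl h)
    then show ?case using gen by auto
  next
    case (inv h)
    then show ?case using gen \<open>\<And>j. j \<in> {1..3} \<Longrightarrow> m_inv W_D6 (tH j) = tH j\<close> by auto
  next
    case (eng h1 h2)
    then obtain js ls where "set js \<subseteq> {1..3}" "h1 = word_prod tH js" "set ls \<subseteq> {1..3}"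
      "h2 = word_prod tH ls" by blast
    then show ?case unfolding mult by (intro exI[of _ "js @ ls"]) (simp add: word_prod_append)
  qed
qed

section \<open>Consistent words\<close>

lemma Dlength_block_word: "Dlength (word_labels (block j)) = 2"
  by (auto simp: block_def Dlength_def sD_def Transposition.transpose_def)

lemma sD_table:
  "map (sD 1) [1, 2, 3, 4, 5, 6] = [- 2, - 1, 3, 4, 5, 6]"
  "map (sD 2) [1, 2, 3, 4, 5, 6] = [2, 1, 3, 4, 5, 6]"
  "map (sD 3) [1, 2, 3, 4, 5, 6] = [1, 3, 2, 4, 5, 6]"
  "map (sD 4) [1, 2, 3, 4, 5, 6] = [1, 2, 4, 3, 5, 6]"
  "map (sD 5) [1, 2, 3, 4, 5, 6] = [1, 2, 3, 5, 4, 6]"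
  "map (sD 6) [1, 2, 3, 4, 5, 6] = [1, 2, 3, 4, 6, 5]"
  by (simp_all add: sD_def Transposition.transpose_def)

lemma S_reduced_words_tH:
  assumes "j \<in> {1..3}"
  shows "S_reduced_words (tH j) = {block j, rev (block j)}"
proof -
  have *: "S_reduced_words (tH j) = {ks \<in> words_for {1..6} sD (tH j). length ks = 2}"
    using S_reduced_words_expand[of "[j]"] by (simp add: Dlength_block_word)
  have "rev (block j) \<in> words_for {1..6} sD (tH j)" "block j \<in> words_for {1..6} sD (tH j)"
    using sD_commute by (auto simp: words_for_def block_def tH_def)
  moreover have "length (block j) = 2" by (simp add: block_def)
  moreover have "ks \<in> {block j, rev (block j)}" if ks: "ks \<in> words_for {1..6} sD (tH j)" "length ks = 2" for ks
  proof -
    obtain a b where ab: "ks = [a, b]" "a \<in> {1..6}" "b \<in> {1..6}"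
      using ks by (auto simp: words_for_def length_Suc_conv numeral_2_eq_2)
    \<comment> \<open>All 36 two-letter words are compared with the block on the values at 1, ...,
      6.\<close>
    have eq: "sD a (sD b i) = word_prod sD (block j) i" for i
      using ks ab by (auto simp: words_for_def word_prod_block fun_eq_iff)
    note eqs = eq[of 1] eq[of 2] eq[of 3] eq[of 4] eq[of 5] eq[of 6]
    have minus: "sD k (- i) = - sD k i" if "k \<in> {1..6}" for k i
      using signed_minus[OF signed_sD[OF that]] .
    note table = sD_table[simplified] minus[of 1, simplified] minus[of 4, simplified]
      minus[of 2, simplified] minus[of 3, simplified] minus[of 5, simplified] minus[of 6, simplified]
    have "ks \<in> {[2, 4], rev [2, 4]}" if "j = 1"
      using eqs unfolding ab(1) that block_eqs
      by - (rule index_cases[OF ab(2)]; rule index_cases[OF ab(3)],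
        simp_all add: table)
    moreover have "ks \<in> {[3, 5], rev [3, 5]}" if "j = 2"
      using eqs unfolding ab(1) that block_eqs
      by - (rule index_cases[OF ab(2)]; rule index_cases[OF ab(3)],
        simp_all add: table)
    moreover have "ks \<in> {[1, 6], rev [1, 6]}" if "j = 3"
      using eqs unfolding ab(1) that block_eqs
      by - (rule index_cases[OF ab(2)]; rule index_cases[OF ab(3)],
        simp_all add: table)
    ultimately show ?thesis by - (rule T_index_cases[OF assms]; simp add: block_def)
  qed
  ultimately show ?thesis unfolding * by auto
qed

text \<open>The other letter of the block acts on positions disjoint from those of the tile. If it
  rearranges edges above the tile, their sum is unchanged, so the tile stays in place.\<close>

lemma step_tiles_commute:
  assumes ks: "set ks \<subseteq> {1..6}"
  shows
    "step_tiles \<theta> U 1 (sD 6 \<circ> word_prod sD ks) = step_tiles \<theta> U 1 (word_prod sD ks)"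
    "step_tiles \<theta> U 6 (sD 1 \<circ> word_prod sD ks) = step_tiles \<theta> U 6 (word_prod sD ks)"
    "step_tiles \<theta> U 2 (sD 4 \<circ> word_prod sD ks) = step_tiles \<theta> U 2 (word_prod sD ks)"
    "step_tiles \<theta> U 4 (sD 2 \<circ> word_prod sD ks) = step_tiles \<theta> U 4 (word_prod sD ks)"
    "step_tiles \<theta> U 3 (sD 5 \<circ> word_prod sD ks) = step_tiles \<theta> U 3 (word_prod sD ks)"
    "step_tiles \<theta> U 5 (sD 3 \<circ> word_prod sD ks) = step_tiles \<theta> U 5 (word_prod sD ks)"
proof -
  note simps = positions_def sD_def Transposition.transpose_def add_ac
  show "step_tiles \<theta> U 1 (sD 6 \<circ> word_prod sD ks) = step_tiles \<theta> U 1 (word_prod sD ks)"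
    using step_tiles_one[of "6 # ks" \<theta> U] step_tiles_one[OF ks, of \<theta> U] ks
    by (simp add: simps)
  show "step_tiles \<theta> U 6 (sD 1 \<circ> word_prod sD ks) = step_tiles \<theta> U 6 (word_prod sD ks)"
    using step_tiles_ge_two[of "1 # ks" 6 \<theta> U] step_tiles_ge_two[OF ks, of 6 \<theta> U] ks
    by (simp add: simps)
  show "step_tiles \<theta> U 2 (sD 4 \<circ> word_prod sD ks) = step_tiles \<theta> U 2 (word_prod sD ks)"
    using step_tiles_ge_two[of "4 # ks" 2 \<theta> U] step_tiles_ge_two[OF ks, of 2 \<theta> U] ks
    by (simp add: simps)
  show "step_tiles \<theta> U 4 (sD 2 \<circ> word_prod sD ks) = step_tiles \<theta> U 4 (word_prod sD ks)"
    using step_tiles_ge_two[of "2 # ks" 4 \<theta> U] step_tiles_ge_two[OF ks, of 4 \<theta> U] ks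
    by (simp add: simps)
  show "step_tiles \<theta> U 3 (sD 5 \<circ> word_prod sD ks) = step_tiles \<theta> U 3 (word_prod sD ks)"
    using step_tiles_ge_two[of "5 # ks" 3 \<theta> U] step_tiles_ge_two[OF ks, of 3 \<theta> U] ks
    by (simp add: simps)
  show "step_tiles \<theta> U 5 (sD 3 \<circ> word_prod sD ks) = step_tiles \<theta> U 5 (word_prod sD ks)"
    using step_tiles_ge_two[of "3 # ks" 5 \<theta> U] step_tiles_ge_two[OF ks, of 5 \<theta> U] ks
    by (simp add: simps)
qed

lemma word_tiling_rev_block:
  assumes "set ks \<subseteq> {1..6}"
  shows "word_tiling \<theta> U (rev (block j) @ ks) = word_tiling \<theta> U (block j @ ks)"
proof -
  obtain a b where ab: "block j = [a, b]" "(a, b) \<in> {(2, 4), (3, 5), (1, 6)}"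
    using block_pair by blast
  have "step_tiles \<theta> U a (sD b \<circ> word_prod sD ks) = step_tiles \<theta> U a (word_prod sD ks)"
    "step_tiles \<theta> U b (sD a \<circ> word_prod sD ks) = step_tiles \<theta> U b (word_prod sD ks)"
    using ab(2) step_tiles_commute[OF assms] by auto
  then show ?thesis by (auto simp: ab(1))
qed

text \<open>The tiles added by \<open>ms\<close> depend on the later part of the list only through
  its product.\<close>

lemma word_tiling_append_cong:
  assumes "word_prod sD ks = word_prod sD ls" "word_tiling \<theta> U ks = word_tiling \<theta> U ls"
  shows "word_tiling \<theta> U (ms @ ks) = word_tiling \<theta> U (ms @ ls)"
  using assms by (induction ms) (simp_all add: word_prod_append)

lemma Sigma_consistent_expand:
  assumes "Sigma_consistent ks"
  shows "\<exists>js. set js \<subseteq> {1..3} \<and> word_prod sD ks = word_prod tH js \<and> length ks = 2 * length js \<and>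
    word_tiling \<theta> U ks = word_tiling \<theta> U (expand js)"
proof -
  obtain bs where ks: "ks = concat bs" and bs: "\<forall>b \<in> set bs. \<exists>j \<in> {1..3}. b \<in> S_reduced_words (tH j)"
    using assms by (auto simp: Sigma_consistent_def)
  show ?thesis
    unfolding ks using bs
  proof (induction bs)
    case Nil
    then show ?case by (intro exI[of _ "[]"]) simp
  next
    case (Cons b bs)
    then obtain js where js: "set js \<subseteq> {1..3}" "word_prod sD (concat bs) = word_prod tH js"
      "length (concat bs) = 2 * length js"
      "word_tiling \<theta> U (concat bs) = word_tiling \<theta> U (expand js)" by auto
    obtain j where j: "j \<in> {1..3}" "b \<in> S_reduced_words (tH j)" using Cons.prems by auto
    then have b: "b = block j \<or> b = rev (block j)" "word_prod sD b = tH j"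
      using S_reduced_words_tH[OF j(1)]
      by (auto simp: S_reduced_words_def reduced_words_def words_for_def)
    have "word_tiling \<theta> U (b @ concat bs) = word_tiling \<theta> U (b @ expand js)"
      using js by (intro word_tiling_append_cong) (simp_all add: word_prod_expand)
    also have "\<dots> = word_tiling \<theta> U (block j @ expand js)"
      using b word_tiling_rev_block[OF set_expand] by auto
    finally have "word_tiling \<theta> U (concat (b # bs)) = word_tiling \<theta> U (expand (j # js))" by simp
    moreover have "length b = 2" using b by (auto simp: block_def)
    ultimately show ?case
      using js j b by (intro exI[of _ "j # js"]) (simp add: word_prod_append)
  qed
qed

lemma Sigma_consistent_expandI:
  assumes "set js \<subseteq> {1..3}"
  shows "Sigma_consistent (expand js)"
  unfolding Sigma_consistent_def expand_def
  using assms S_reduced_words_tH by (intro exI[of _ "map block js"]) fastforce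

section \<open>Distinct words give distinct tilings\<close>

context
  fixes \<theta> :: "nat \<Rightarrow> real"
  assumes \<theta>: "edge_angles \<theta>"
begin

text \<open>Each block has exactly one letter among 1, 2, 3, so these letters identify the
  generators in \<open>T\<close>. For letters 2 and 3 the upper of the two rhombi is chosen. The
  left side of the tile consists of \<open>m\<close> edges starting at index \<open>n\<close>, that
  is, at position 3 for \<open>k = 3\<close> and at position 2 otherwise.\<close>

lemma central_tile:
  fixes U :: complex
  assumes ks: "set ks \<subseteq> {1..6}" and asc: "ascent k (word_labels ks)" and k: "k \<in> {1, 2, 3}"
  defines "P \<equiv> label_path \<theta> (word_labels ks)"
  defines "n \<equiv> (if k = 3 then 3 else 4 :: nat)" and "m \<equiv> (if k = 1 then 4 else 2 :: nat)"
  defines "q \<equiv> U + sum_list (take n P)"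
  obtains M where "left_of q (take m (drop n P)) M"
    "enclosed (polyline q (take m (drop n P))) (polyline q M)
      \<in> step_tiles \<theta> U k (word_prod sD ks)"
proof -
  define r where "r = word_labels ks"
  have r: "signed r" using ks by (simp add: r_def signed_word_labels)
  have asc': "ascent k r" using asc by (simp add: r_def)
  have P: "P = map (\<lambda>i. edge \<theta> (r i)) positions" by (simp add: P_def label_path_def r_def)
  consider "k = 1" | "k = 2" | "k = 3" using k by auto
  then show ?thesis
  proof cases
    case 1
    then show ?thesis
      using that left_of_ascent_one[OF \<theta> r asc'[unfolded 1], of q] step_tiles_one[OF ks, of \<theta> U]
      by (simp add: P q_def n_def m_def positions_def r_def)
  next
    case 2
    then show ?thesis
      using that left_of_ascent_ge_two[OF \<theta> r asc', of q] step_tiles_ge_two[OF ks, of k \<theta> U]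
      by (simp add: P q_def n_def m_def positions_def r_def)
  next
    case 3
    then show ?thesis
      using that left_of_ascent_ge_two[OF \<theta> r asc', of q] step_tiles_ge_two[OF ks, of k \<theta> U]
      by (simp add: P q_def n_def m_def positions_def r_def)
  qed
qed

text \<open>The tiles added right of a path by \<open>s\<^sub>1\<close>, \<open>s\<^sub>2\<close> and \<open>s\<^sub>3\<close> all contain the edge in position \<open>2\<close>, so
  they overlap, but they have different vertical extents.\<close>

lemma central_tiles_incompatible:
  assumes ks: "set ks \<subseteq> {1..6}" and k: "k \<in> {1, 2, 3}" "l \<in> {1, 2, 3}" "k \<noteq> l"
    and asc: "ascent k (word_labels ks)" "ascent l (word_labels ks)"
    and sub: "step_tiles \<theta> U k (word_prod sD ks) \<subseteq> T" "step_tiles \<theta> U l (word_prod sD ks) \<subseteq> T"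
  shows "\<not> pairwise (\<lambda>R R'. interior R \<inter> interior R' = {}) T"
proof
  assume T: "pairwise (\<lambda>R R'. interior R \<inter> interior R' = {}) T"
  define e where "e = (\<lambda>i. edge \<theta> (word_labels ks i))"
  define P where "P = label_path \<theta> (word_labels ks)"
  define n where "n = (\<lambda>k :: nat. if k = 3 then 3 else 4 :: nat)"
  define m where "m = (\<lambda>k :: nat. if k = 1 then 4 else 2 :: nat)"
  define X where "X = (\<lambda>k. take (n k) P)"
  define M where "M = (\<lambda>k. take (m k) (drop (n k) P))"
  define Z where "Z = (\<lambda>k. drop (m k) (drop (n k) P))"
  define q where "q = (\<lambda>k. U + sum_list (X k))"
  have P: "X k @ M k @ Z k = P" for k by (simp add: X_def M_def Z_def del: drop_drop)
  have down: "down P" unfolding P_def by (rule down_label_path[OF \<theta> signed_word_labels[OF ks]])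
  have P_eq: "P = map e positions" by (simp add: P_def label_path_def e_def)
  have neg: "Im (e 3) < 0" "Im (e 2) < 0" "Im (e 1) < 0" "Im (e (- 1)) < 0" "Im (e (- 2)) < 0"
    using down unfolding P_eq positions_def by simp_all
  obtain A where A: "left_of (q k) (M k) A"
    "enclosed (polyline (q k) (M k)) (polyline (q k) A) \<in> T"
    using central_tile[OF ks asc(1) k(1), of U] sub(1)
    unfolding q_def X_def M_def n_def m_def P_def by blast
  obtain B where B: "left_of (q l) (M l) B"
    "enclosed (polyline (q l) (M l)) (polyline (q l) B) \<in> T"
    using central_tile[OF ks asc(2) k(2), of U] sub(2)
    unfolding q_def X_def M_def n_def m_def P_def by blast
  let ?A = "enclosed (polyline (q k) (M k)) (polyline (q k) A)"
  let ?B = "enclosed (polyline (q l) (M l)) (polyline (q l) B)"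
  \<comment> \<open>The height of the midpoint of the edge in position 2, which has index 4.\<close>
  define y where "y = Im (U + sum_list (take 4 P)) + Im (e 2) / 2"
  have y: "Im (U + sum_list (X j @ M j)) < y" "y < Im (U + sum_list (X j))" if "j \<in> {1, 2, 3}" for j
    using that neg by (auto simp: y_def X_def M_def n_def m_def P_eq positions_def)
  have "interior ?A \<inter> interior ?B \<noteq> {}"
    unfolding q_def
  proof (rule moves_overlap)
    show "X k @ M k @ Z k = X l @ M l @ Z l" "down (X k @ M k @ Z k)" using P down by simp_all
  qed (use A B y k in \<open>auto simp: q_def\<close>)
  then have "?A = ?B" using T A(2) B(2) unfolding pairwise_def by blast
  then have "{Im (q k + sum_list (M k))..Im (q k)} = {Im (q l + sum_list (M l))..Im (q l)}"
    using Im_image_enclosed[OF A(1)] Im_image_enclosed[OF B(1)] by metis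
  moreover have "Im (q j + sum_list (M j)) \<le> Im (q j)" if "j \<in> {1, 2, 3}" for j
    using y[OF that] by (simp add: q_def add.assoc)
  ultimately have "Im (q k + sum_list (M k)) = Im (q l + sum_list (M l)) \<and> Im (q k) = Im (q l)"
    using k(1,2) unfolding Icc_eq_Icc by blast
  \<comment> \<open>The top separates letter 3 from 1 and 2; the bottom separates the megatile of 1
    from the rhombus of 2.\<close>
  then show False
    using k neg by (auto simp: q_def X_def M_def n_def m_def P_eq positions_def)
qed

lemma ascending_append: "ascending (ks @ ls) \<Longrightarrow> ascending ls"
  by (induction ks) auto

lemma word_tiling_append: "word_tiling \<theta> U ls \<subseteq> word_tiling \<theta> U (ks @ ls)"
  by (induction ks) auto

text \<open>In the block \<open>[a, b]\<close> the letter \<open>a\<close> is added after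
  \<open>b\<close>. Since the letters commute, its tile may be regarded as added directly to the
  path of \<open>expand js\<close>, the path that two words with the common end \<open>js\<close>
  share.\<close>

lemma expand_step:
  assumes j: "block j = [a, b]" and asc: "ascending (expand (p @ j # js))"
  shows "ascent a (word_labels (expand js))"
    and "step_tiles \<theta> U a (word_prod sD (expand js)) \<subseteq> word_tiling \<theta> U (expand (p @ j # js))"
proof -
  have ab: "(a, b) \<in> {(2, 4), (3, 5), (1, 6)}" using j block_pair[of j] by auto
  have "ascending ([a, b] @ expand js)"
    using asc j by - (rule ascending_append[of "expand p"], simp)
  then show "ascent a (word_labels (expand js))" using ascent_commute[OF ab] by simp
  have "step_tiles \<theta> U a (word_prod sD (expand js)) =
      step_tiles \<theta> U a (sD b \<circ> word_prod sD (expand js))"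
    using ab step_tiles_commute[OF set_expand] by auto
  then have "step_tiles \<theta> U a (word_prod sD (expand js)) \<subseteq> word_tiling \<theta> U (expand (j # js))"
    using j by simp
  also have "\<dots> \<subseteq> word_tiling \<theta> U (expand (p @ j # js))"
    using word_tiling_append[of U "expand (j # js)" "expand p"] by simp
  finally show "step_tiles \<theta> U a (word_prod sD (expand js)) \<subseteq> word_tiling \<theta> U (expand (p @ j # js))" .
qed

lemma word_tiling_expand_inj:
  assumes js: "set js \<subseteq> {1..3}" "ascending (expand js)"
    and ls: "set ls \<subseteq> {1..3}" "ascending (expand ls)"
    and len: "length js = length ls"
    and eq: "word_tiling \<theta> U (expand js) = word_tiling \<theta> U (expand ls)"
  shows "js = ls"
proof (rule ccontr)
  assume "js \<noteq> ls"
  \<comment> \<open>Letters are added from the right end of the list, so the words are compared from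
    there; equal lengths ensure that neither is a proper suffix of the other.\<close>
  then have "rev js \<noteq> rev ls" "length (rev js) = length (rev ls)" using len by auto
  then obtain q i js' l ls' where "i \<noteq> l" "rev js = q @ [i] @ js'" "rev ls = q @ [l] @ ls'"
    using same_length_different by blast
  then have split: "js = rev js' @ i # rev q" "ls = rev ls' @ l # rev q"
    by (simp_all add: rev_eq_append_conv)
  obtain a b c d where blocks: "block i = [a, b]" "block l = [c, d]" by (metis block_pair)
  have il: "i \<in> {1..3}" "l \<in> {1..3}" using js ls split by auto
  then have ac: "a \<in> {1, 2, 3}" "c \<in> {1, 2, 3}" "a \<noteq> c"
    using blocks \<open>i \<noteq> l\<close>
    by - (rule T_index_cases[OF il(1)]; rule T_index_cases[OF il(2)]; auto simp: block_def)+
  note first = expand_step[OF blocks(1) js(2)[unfolded split]]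
  note second = expand_step[OF blocks(2) ls(2)[unfolded split]]
  have "tiling_of (Y_polygon \<theta> U (word_prod sD (expand js))) (word_tiling \<theta> U (expand js))"
    by (rule word_tiling_tiling_of[OF \<theta> set_expand js(2)])
  then have "pairwise (\<lambda>R R'. interior R \<inter> interior R' = {}) (word_tiling \<theta> U (expand js))"
    by (simp add: tiling_of_def)
  moreover have "step_tiles \<theta> U a (word_prod sD (expand (rev q))) \<subseteq> word_tiling \<theta> U (expand js)"
    "step_tiles \<theta> U c (word_prod sD (expand (rev q))) \<subseteq> word_tiling \<theta> U (expand js)"
    using first(2)[of U] second(2)[of U] eq split by simp_all
  ultimately show False
    using central_tiles_incompatible[OF set_expand ac first(1) second(1)] by blast
qed

end

theorem mainTheorem3:
  fixes \<theta> :: "nat \<Rightarrow> real" and U :: complex and x :: "int \<Rightarrow> int"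
  assumes "edge_angles \<theta>" and "x \<in> X_H3"
  shows "\<exists>f. bij_betw f (T_reduced_words x) (tilings_X \<theta> U x)"
proof -
  obtain w where x: "x = word_prod tH w" using X_H3_word[OF assms(2)] by blast
  define n where "n = Dlength (word_labels (expand w))"
  \<comment> \<open>Both kinds of reduced words are cut out by the same number \<open>n\<close>, so
    replacing letters by blocks, or blocks by letters, preserves reducedness.\<close>
  have T: "T_reduced_words x = {js \<in> words_for {1..3} tH x. 2 * length js = n}"
    and S: "S_reduced_words x = {ks \<in> words_for {1..6} sD x. length ks = n}"
    unfolding x n_def by (rule T_reduced_words_expand S_reduced_words_expand)+
  have asc: "ascending ks" if "ks \<in> S_reduced_words x" for ks
  proof -
    have ks: "set ks \<subseteq> {1..6}" "word_prod sD ks = word_prod sD (expand w)" "length ks = n"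
      using that unfolding S by (auto simp: words_for_def x word_prod_expand)
    then have "word_labels ks = word_labels (expand w)"
      using word_prod_eq_iff[OF ks(1) set_expand] by blast
    then show ?thesis using Dlength_le_length(2)[OF ks(1)] ks(3) by (simp add: n_def)
  qed
  have exp: "expand js \<in> S_reduced_words x" if "js \<in> T_reduced_words x" for js
    using that set_expand unfolding S T
    by (auto simp: words_for_def word_prod_expand length_expand)
  define f where "f = (\<lambda>js. word_tiling \<theta> U (expand js))"
  have "inj_on f (T_reduced_words x)"
  proof (rule inj_onI)
    fix js ls assume *: "js \<in> T_reduced_words x" "ls \<in> T_reduced_words x" "f js = f ls"
    show "js = ls"
    proof (rule word_tiling_expand_inj[OF assms(1)])
      show "set js \<subseteq> {1..3}" "set ls \<subseteq> {1..3}" "length js = length ls"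
        using * unfolding T words_for_def by auto
    qed (use * asc exp in \<open>auto simp: f_def\<close>)
  qed
  moreover have "f ` T_reduced_words x = tilings_X \<theta> U x"
  proof (intro equalityI subsetI)
    fix \<T> assume "\<T> \<in> f ` T_reduced_words x"
    then obtain js where js: "js \<in> T_reduced_words x" "\<T> = word_tiling \<theta> U (expand js)"
      by (auto simp: f_def)
    have x_eq: "word_prod sD (expand js) = x" and "set js \<subseteq> {1..3}"
      using js(1) unfolding T words_for_def by (auto simp: word_prod_expand)
    then have "Sigma_consistent (expand js)" by (intro Sigma_consistent_expandI)
    moreover have "tiling_of (Y_polygon \<theta> U x) \<T>"
      using word_tiling_tiling_of[OF assms(1) set_expand asc[OF exp[OF js(1)]], of U]
      by (simp add: x_eq js(2))
    ultimately show "\<T> \<in> tilings_X \<theta> U x"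
      using exp[OF js(1)] js(2) by (auto simp: tilings_X_def)
  next
    fix \<T> assume "\<T> \<in> tilings_X \<theta> U x"
    then obtain ks where ks: "ks \<in> S_reduced_words x" "Sigma_consistent ks" "\<T> = word_tiling \<theta> U ks"
      by (auto simp: tilings_X_def)
    obtain js where js: "set js \<subseteq> {1..3}" "word_prod sD ks = word_prod tH js"
      "length ks = 2 * length js" "word_tiling \<theta> U ks = word_tiling \<theta> U (expand js)"
      using Sigma_consistent_expand[OF ks(2)] by blast
    then have "js \<in> T_reduced_words x"
      using ks(1) unfolding T S by (auto simp: words_for_def)
    then show "\<T> \<in> f ` T_reduced_words x" using ks(3) js(4) by (auto simp: f_def)
  qed
  ultimately show ?thesis unfolding bij_betw_def by blast
qed

end
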